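(* Let $\mathcal{A}\subset\mathbb{R}^n$ be compact and let $\mathcal{H}_c=(C,f,D,g)$ be a hybrid system whose input affects only the flows, i.e. $\dot x=f(x,u_c)$, $(x,u_c)\in C$; $x^+=g(x)$, $x\in D$, satisfying the hybrid basic conditions. Suppose there exists a control Lyapunov function $V$ with $\mathcal{U}$ controls for $\mathcal{H}_c$ (with respect to $\mathcal{A}$). Suppose furthermore that: (M1c) the set-valued map $\Psi_c$ is lower semicontinuous with convex values; (M2c) for every $r>0$ and every $x\in\Pi(C)\cap\mathcal{I}(r)$, the function $u_c\mapsto\Gamma_c(x,u_c,r)$ is convex on $\Psi_c(x)$. Then for every $r>0$ there exists a state-feedback law $\rho'_c:\Pi(C)\to\mathcal{U}_c$, given on $R_c\cap\mathcal{I}(r)$ by $$\rho'_c(x):=\arg\min\{|u_c| : u_c\in\mathcal{T}_c(x)\}\quad\forall x\in R_c\cap\mathcal{I}(r),$$ that renders the compact set $\mathcal{A}_r:=\{x\in\mathbb{R}^n:V(x)\le r\}$ asymptotically stable for $\mathcal{H}_c$. Moreover, if $\Psi_c$ has a closed graph then $\rho'_c$ is continuous on $\Pi(C)\cap\mathcal{I}(r)$. Furthermore, if the zero feedback law $\rho_{c,0}:\mathbb{R}^n\to\{0\}\subset\mathcal{U}_c$ is such that (M3) every maximal solution $t\mapsto\phi(t,0)$ to $\dot x=f(x,\rho_{c,0}(x))$, $x\in\Pi(C)\cap\mathcal{A}$, satisfies $|\phi(t,0)|_{\mathcal{A}}=0$ for all $(t,0)\in\mathrm{dom}\,\phi$,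 and if (M5) the set-valued map $\mathcal{T}'_c$ (built with this $\rho_{c,0}$) is lower semicontinuous at each $x\in\Pi(C)\cap\mathcal{I}(0)$, then the feedback law $$\rho_c(x):=\arg\min\{|u_c| : u_c\in\mathcal{T}'_c(x)\}\quad\forall x\in\Pi(C)$$ is globally asymptotically stabilizing, i.e. it renders $\mathcal{A}$ globally asymptotically stable for $\mathcal{H}_c$. Furthermore, if $\Psi_c$ has closed graph then $\rho_c$ is continuous.
   Context: Hybrid system. Let $\mathcal{U}=\mathcal{U}_c\subset\mathbb{R}^{m_c}$, $C\subset\mathbb{R}^n\times\mathcal{U}_c$, $D\subset\mathbb{R}^n$, $f:\mathbb{R}^n\times\mathbb{R}^{m_c}\to\mathbb{R}^n$, $g:\mathbb{R}^n\to\mathbb{R}^n$. The system $\mathcal{H}_c=(C,f,D,g)$ satisfies the hybrid basic conditions if $C$ is a closed subset of $\mathbb{R}^n\times\mathcal{U}_c$, $D$ is a closed subset of $\mathbb{R}^n$, and $f$ and $g$ are continuous. Projections. $\Pi(C)=\{x:\exists u_c\in\mathcal{U}_c,\ (x,u_c)\in C\}$; $\Psi_c(x)=\{u_c:(x,u_c)\in C\}$ for $x\in\mathbb{R}^n$. A set-valued map $S:\mathbb{R}^n\rightrightarrows\mathbb{R}^m$ is lower semicontinuous at $x$ if $\liminf_{x_i\to x}S(x_i)\supset S(x)$, where $\liminf_{x_i\to x}S(x_i)=\{z:\forall x_i\to x,\ \exists z_i\to z\text{ s.t. }z_i\in S(x_i)\}$; it is lower semicontinuous if this holds at each $x\in\mathbb{R}^n$.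 Control Lyapunov function (CLF). $|\cdot|$ is the Euclidean norm and $|x|_{\mathcal{A}}=\inf_{y\in\mathcal{A}}|x-y|$. Class $\mathcal{K}_\infty$: functions $[0,\infty)\to[0,\infty)$ that are continuous, zero at zero, strictly increasing and unbounded. A continuous function $V:\mathbb{R}^n\to\mathbb{R}$, continuously differentiable on an open set containing $\overline{\Pi(C)}$, is a CLF with $\mathcal{U}$ controls for $\mathcal{H}_c$ if there exist $\alpha_1,\alpha_2\in\mathcal{K}_\infty$ and a positive definite function $\alpha_3$ such that - $\alpha_1(|x|_{\mathcal{A}})\le V(x)\le\alpha_2(|x|_{\mathcal{A}})$ for all $x\in\Pi(C)\cup D\cup g(D)$; - $\inf_{u_c\in\Psi_c(x)}\langle\nabla V(x),f(x,u_c)\rangle\le-\alpha_3(|x|_{\mathcal{A}})$ for all $x\in\Pi(C)$; - $V(g(x))-V(x)\le-\alpha_3(|x|_{\mathcal{A}})$ for all $x\in D$. Derived objects (for the given $V$, $\alpha_3$). For $r\ge0$, $\mathcal{I}(r)=\{x\in\mathbb{R}^n:V(x)\ge r\}$. $\Gamma_c(x,u_c,r)=\langle\nabla V(x),f(x,u_c)\rangle+\alpha_3(|x|_{\mathcal{A}})$ if $(x,u_c)\in C\cap(\mathcal{I}(r)\times\mathbb{R}^{m_c})$, and $-\infty$ otherwise. $\mathcal{T}_c(x)=\Psi_c(x)\cap\{u_c\in\mathcal{U}_c:\Gamma_c(x,u_c,V(x))\le0\}$; $R_c=\Pi(C)\cap\{x:V(x)>0\}$. $S^\circ_c(x,r)=\{u_c\in\mathcal{U}_c:\Gamma_c(x,u_c,r)\le0\}$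 if $x\in\Pi(C)\cap\mathcal{I}(r)$, and $S^\circ_c(x,r)=\mathbb{R}^{m_c}$ otherwise. Given $\rho_{c,0}$, $S'_c(x,r)=S^\circ_c(x,r)$ if $r>0$ and $S'_c(x,r)=\{\rho_{c,0}(x)\}$ if $r=0$; $\mathcal{T}'_c(x)=\Psi_c(x)\cap S'_c(x,V(x))$. Closed loop. Applying a feedback $\rho_c$ to $\mathcal{H}_c$ gives $\dot x=f(x,\rho_c(x))$ for $x\in\{x:(x,\rho_c(x))\in C\}$ ($x$ ranging over the domain of $\rho_c$) and $x^+=g(x)$ for $x\in D$. Solutions. A hybrid time domain is a set $E\subset[0,\infty)\times\mathbb{N}$ such that for each $(T,J)\in E$, $E\cap([0,T]\times\{0,\dots,J\})=\bigcup_{j}([t_j,t_{j+1}],j)$ for a finite sequence $0=t_0\le t_1\le\cdots$. Solutions of the closed loop are functions $\phi$ on hybrid time domains, with $t\mapsto\phi(t,j)$ absolutely continuous on $\{t:(t,j)\in\mathrm{dom}\,\phi\}$ for each $j$, satisfying the flow dynamics along each such interval and the jump dynamics at each jump. A solution is complete if its domain is unbounded and maximal if it is not a truncation of another solution to a proper subset of the latter's domain. Asymptotic stability. A compact set $K$ is asymptotically stable for a closed-loop system if: for each $\varepsilon>0$ there exists $\delta>0$ such that each maximal solution $\phi$ starting from $K+\delta\mathbb{B}$ satisfies $\phi(t,j)\in K+\varepsilon\mathbb{B}$ for each $(t,j)\in\mathrm{dom}\,\phi$; and each maximal solution is bounded and the complete ones satisfy $\lim_{t+j\to\infty}|\phi(t,j)|_K=0$.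 Here $\mathbb{B}$ is the closed unit ball. The second property is required of all maximal solutions from every initial condition, so "globally asymptotically stable" refers to the same two properties.
   Formalization: In the first part, existence and continuity are for T_c built with any rate strictly below α3 (false for α3 itself); A_r is assumed compact for stabilization; minimizers defining ρ_c are assumed to exist; A is nonempty, α3 continuous, C closed in the whole product space. *)

theory Defs
  imports "HOL-Analysis.Analysis"
begin

section \<open>Hybrid systems whose input affects only the flows\<close>

text \<open>Data: input set \<open>U\<close>, flow set \<open>C\<close>, jump set \<open>D\<close>, flow map \<open>f\<close>, jump map \<open>g\<close>.  The flow set
  is closed in the whole product space, not merely relatively to \<open>UNIV \<times> U\<close>.\<close>

definition hybrid_basic_conditions ::
  "'u::euclidean_space set \<Rightarrow> ('x::euclidean_space \<times> 'u) set \<Rightarrow> 'x set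
    \<Rightarrow> ('x \<times> 'u \<Rightarrow> 'x) \<Rightarrow> ('x \<Rightarrow> 'x) \<Rightarrow> bool" where
  "hybrid_basic_conditions U C D f g \<longleftrightarrow>
     closed C \<and> C \<subseteq> UNIV \<times> U \<and> closed D \<and> continuous_on UNIV f \<and> continuous_on UNIV g"

definition state_proj :: "'u set \<Rightarrow> ('x \<times> 'u) set \<Rightarrow> 'x set" where
  "state_proj U C = {x. \<exists>u\<in>U. (x, u) \<in> C}"

definition input_map :: "('x \<times> 'u) set \<Rightarrow> 'x \<Rightarrow> 'u set" where
  "input_map C x = {u. (x, u) \<in> C}"

section \<open>Set-valued maps\<close>

text \<open>As for every limit statement, the selection \<open>z i \<in> S (y i)\<close> is required for all large \<open>i\<close>.  The
  sequences \<open>y\<close> range over the whole space.\<close>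

definition setmap_liminf ::
  "('x::topological_space \<Rightarrow> 'u::topological_space set) \<Rightarrow> 'x \<Rightarrow> 'u set" where
  "setmap_liminf S x =
     {z. \<forall>y::nat \<Rightarrow> 'x. y \<longlonglongrightarrow> x \<longrightarrow>
           (\<exists>w. w \<longlonglongrightarrow> z \<and> (\<forall>\<^sub>F i in sequentially. w i \<in> S (y i)))}"

definition lsc_at :: "('x::topological_space \<Rightarrow> 'u::topological_space set) \<Rightarrow> 'x \<Rightarrow> bool" where
  "lsc_at S x \<longleftrightarrow> S x \<subseteq> setmap_liminf S x"

definition closed_graph :: "('x::topological_space \<Rightarrow> 'u::topological_space set) \<Rightarrow> bool" where
  "closed_graph S \<longleftrightarrow> closed {(x, u). u \<in> S x}"

section \<open>Control Lyapunov functions\<close>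

text \<open>Comparison functions live on the half-line; their values at negative arguments are irrelevant.
  Positive definite functions are continuous by convention.\<close>

definition class_K_inf :: "(real \<Rightarrow> real) \<Rightarrow> bool" where
  "class_K_inf \<alpha> \<longleftrightarrow>
     continuous_on {0..} \<alpha> \<and> \<alpha> 0 = 0 \<and> strict_mono_on {0..} \<alpha> \<and> (\<forall>M. \<exists>s\<ge>0. \<alpha> s > M)"

definition positive_definite :: "(real \<Rightarrow> real) \<Rightarrow> bool" where
  "positive_definite \<alpha> \<longleftrightarrow> continuous_on {0..} \<alpha> \<and> \<alpha> 0 = 0 \<and> (\<forall>s>0. \<alpha> s > 0)"

definition grad :: "('x::real_inner \<Rightarrow> real) \<Rightarrow> 'x \<Rightarrow> 'x" where
  "grad V x = (THE d. GDERIV V x :> d)"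

definition C1_on :: "'x::real_inner set \<Rightarrow> ('x \<Rightarrow> real) \<Rightarrow> bool" where
  "C1_on S V \<longleftrightarrow> (\<forall>x\<in>S. \<exists>d. GDERIV V x :> d) \<and> continuous_on S (grad V)"

text \<open>\<open>V\<close> is a control Lyapunov function with decay rate \<open>\<alpha>3\<close>; \<open>infdist x A\<close> is the distance to \<open>A\<close>.
  The infimum is taken in the extended reals since it may be \<open>-\<infinity>\<close>.\<close>

definition control_lyapunov_function ::
  "'u::euclidean_space set \<Rightarrow> ('x::euclidean_space \<times> 'u) set \<Rightarrow> 'x set
    \<Rightarrow> ('x \<times> 'u \<Rightarrow> 'x) \<Rightarrow> ('x \<Rightarrow> 'x) \<Rightarrow> 'x set
    \<Rightarrow> ('x \<Rightarrow> real) \<Rightarrow> (real \<Rightarrow> real) \<Rightarrow> bool" where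
  "control_lyapunov_function U C D f g A V \<alpha>3 \<longleftrightarrow>
     continuous_on UNIV V \<and>
     (\<exists>W. open W \<and> closure (state_proj U C) \<subseteq> W \<and> C1_on W V) \<and>
     positive_definite \<alpha>3 \<and>
     (\<exists>\<alpha>1 \<alpha>2. class_K_inf \<alpha>1 \<and> class_K_inf \<alpha>2 \<and>
        (\<forall>x \<in> state_proj U C \<union> D \<union> g ` D.
           \<alpha>1 (infdist x A) \<le> V x \<and> V x \<le> \<alpha>2 (infdist x A))) \<and>
     (\<forall>x \<in> state_proj U C.
        (INF u \<in> input_map C x. ereal (grad V x \<bullet> f (x, u))) \<le> ereal (- \<alpha>3 (infdist x A))) \<and>
     (\<forall>x \<in> D. V (g x) - V x \<le> - \<alpha>3 (infdist x A))"

section \<open>Regulation maps\<close>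

text \<open>The rate \<open>\<alpha>\<close> is a parameter of the maps below.  If \<open>\<alpha>\<close> is the rate \<open>\<alpha>3\<close> of the control
  Lyapunov function and \<open>\<alpha>3\<close> is tight, then \<open>T_c\<close> may have empty values (the infimum need not be
  attained) and may fail to be lower semicontinuous, so that the minimum-norm selection is
  discontinuous.  Any positive definite \<open>\<alpha>\<close> below \<open>\<alpha>3\<close> on the positive reals is again a rate for
  the same function and, for convex lower semicontinuous \<open>input_map C\<close> and \<open>Gamma_c\<close> convex in the
  input, avoids both on \<open>R_c\<close>.\<close>

definition superlevel :: "('x \<Rightarrow> real) \<Rightarrow> real \<Rightarrow> 'x set" where
  "superlevel V r = {x. V x \<ge> r}"

definition sublevel :: "('x \<Rightarrow> real) \<Rightarrow> real \<Rightarrow> 'x set" where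
  "sublevel V r = {x. V x \<le> r}"

text \<open>For \<open>x \<in> superlevel V r\<close> the value \<open>-\<infinity>\<close> is not taken on \<open>input_map C x\<close>, so that there
  convexity in \<open>u\<close> can be expressed through \<open>real_of_ereal\<close>.\<close>

definition Gamma_c ::
  "('x::euclidean_space \<times> 'u::euclidean_space) set \<Rightarrow> ('x \<times> 'u \<Rightarrow> 'x) \<Rightarrow> 'x set
    \<Rightarrow> ('x \<Rightarrow> real) \<Rightarrow> (real \<Rightarrow> real) \<Rightarrow> 'x \<Rightarrow> 'u \<Rightarrow> real \<Rightarrow> ereal" where
  "Gamma_c C f A V \<alpha> x u r =
     (if (x, u) \<in> C \<inter> (superlevel V r \<times> UNIV)
      then ereal (grad V x \<bullet> f (x, u) + \<alpha> (infdist x A)) else -\<infinity>)"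

definition T_c ::
  "'u::euclidean_space set \<Rightarrow> ('x::euclidean_space \<times> 'u) set \<Rightarrow> ('x \<times> 'u \<Rightarrow> 'x) \<Rightarrow> 'x set
    \<Rightarrow> ('x \<Rightarrow> real) \<Rightarrow> (real \<Rightarrow> real) \<Rightarrow> 'x \<Rightarrow> 'u set" where
  "T_c U C f A V \<alpha> x = input_map C x \<inter> {u \<in> U. Gamma_c C f A V \<alpha> x u (V x) \<le> 0}"

definition R_c :: "'u set \<Rightarrow> ('x \<times> 'u) set \<Rightarrow> ('x \<Rightarrow> real) \<Rightarrow> 'x set" where
  "R_c U C V = state_proj U C \<inter> {x. V x > 0}"

definition S0_c ::
  "'u::euclidean_space set \<Rightarrow> ('x::euclidean_space \<times> 'u) set \<Rightarrow> ('x \<times> 'u \<Rightarrow> 'x) \<Rightarrow> 'x set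
    \<Rightarrow> ('x \<Rightarrow> real) \<Rightarrow> (real \<Rightarrow> real) \<Rightarrow> 'x \<Rightarrow> real \<Rightarrow> 'u set" where
  "S0_c U C f A V \<alpha> x r =
     (if x \<in> state_proj U C \<inter> superlevel V r
      then {u \<in> U. Gamma_c C f A V \<alpha> x u r \<le> 0} else UNIV)"

text \<open>The level \<open>r\<close> in \<open>S1_c\<close> is nonnegative; \<open>T1_c\<close> only evaluates it at \<open>V x\<close> with \<open>V x \<ge> 0\<close>, since
  off \<open>state_proj U C\<close> the set \<open>input_map C x\<close> is empty.\<close>

definition S1_c ::
  "'u::euclidean_space set \<Rightarrow> ('x::euclidean_space \<times> 'u) set \<Rightarrow> ('x \<times> 'u \<Rightarrow> 'x) \<Rightarrow> 'x set
    \<Rightarrow> ('x \<Rightarrow> real) \<Rightarrow> (real \<Rightarrow> real) \<Rightarrow> ('x \<Rightarrow> 'u) \<Rightarrow> 'x \<Rightarrow> real \<Rightarrow> 'u set" where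
  "S1_c U C f A V \<alpha> \<rho>0 x r = (if r > 0 then S0_c U C f A V \<alpha> x r else {\<rho>0 x})"

definition T1_c ::
  "'u::euclidean_space set \<Rightarrow> ('x::euclidean_space \<times> 'u) set \<Rightarrow> ('x \<times> 'u \<Rightarrow> 'x) \<Rightarrow> 'x set
    \<Rightarrow> ('x \<Rightarrow> real) \<Rightarrow> (real \<Rightarrow> real) \<Rightarrow> ('x \<Rightarrow> 'u) \<Rightarrow> 'x \<Rightarrow> 'u set" where
  "T1_c U C f A V \<alpha> \<rho>0 x = input_map C x \<inter> S1_c U C f A V \<alpha> \<rho>0 x (V x)"

text \<open>\<open>\<rho> x = arg min {\<bar>u\<bar> : u \<in> T x}\<close> for all \<open>x \<in> X\<close>; in particular \<open>\<rho> x \<in> T x\<close>.\<close>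

definition min_norm_law ::
  "('x \<Rightarrow> 'u::real_normed_vector set) \<Rightarrow> 'x set \<Rightarrow> ('x \<Rightarrow> 'u) \<Rightarrow> bool" where
  "min_norm_law T X \<rho> \<longleftrightarrow> (\<forall>x\<in>X. is_arg_min norm (\<lambda>u. u \<in> T x) (\<rho> x))"

section \<open>Solutions of hybrid systems without inputs\<close>

definition hybrid_time_domain :: "(real \<times> nat) set \<Rightarrow> bool" where
  "hybrid_time_domain E \<longleftrightarrow>
     E \<subseteq> {0..} \<times> UNIV \<and>
     (\<forall>(T, J) \<in> E. \<exists>N (t :: nat \<Rightarrow> real).
        t 0 = 0 \<and> (\<forall>j<N. t j \<le> t (Suc j)) \<and>
        E \<inter> ({0..T} \<times> {0..J}) = (\<Union>j<N. {t j..t (Suc j)} \<times> {j}))"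

definition abs_continuous_on :: "real set \<Rightarrow> (real \<Rightarrow> 'x::real_normed_vector) \<Rightarrow> bool" where
  "abs_continuous_on I h \<longleftrightarrow>
     (\<forall>\<epsilon>>0. \<exists>\<delta>>0. \<forall>(n::nat) a b.
        (\<forall>k<n. a k \<le> b k \<and> {a k..b k} \<subseteq> I) \<and>
        pairwise (\<lambda>k l. disjnt {a k<..<b k} {a l<..<b l}) {..<n} \<and>
        (\<Sum>k<n. b k - a k) < \<delta> \<longrightarrow>
        (\<Sum>k<n. norm (h (b k) - h (a k))) < \<epsilon>)"

text \<open>On intervals that are not compact, absolute continuity means absolute continuity on each compact
  subinterval.\<close>

definition locally_abs_continuous_on ::
  "real set \<Rightarrow> (real \<Rightarrow> 'x::real_normed_vector) \<Rightarrow> bool" where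
  "locally_abs_continuous_on I h \<longleftrightarrow> (\<forall>a b. {a..b} \<subseteq> I \<longrightarrow> abs_continuous_on {a..b} h)"

definition time_slice :: "(real \<times> nat) set \<Rightarrow> nat \<Rightarrow> real set" where
  "time_slice E j = {t. (t, j) \<in> E}"

text \<open>\<open>\<phi>\<close> is a solution with domain \<open>E\<close> to the system with flow set \<open>F\<close>, flow map \<open>h\<close>, jump set \<open>D\<close> and
  jump map \<open>g\<close>.  Solutions start from \<open>closure F \<union> D\<close>; along a flow interval, membership in \<open>F\<close> holds
  in the interior and the differential equation almost everywhere.\<close>

definition hybrid_solution ::
  "'x::euclidean_space set \<Rightarrow> ('x \<Rightarrow> 'x) \<Rightarrow> 'x set \<Rightarrow> ('x \<Rightarrow> 'x)
    \<Rightarrow> (real \<times> nat) set \<Rightarrow> (real \<Rightarrow> nat \<Rightarrow> 'x) \<Rightarrow> bool" where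
  "hybrid_solution F h D g E \<phi> \<longleftrightarrow>
     hybrid_time_domain E \<and> (0, 0) \<in> E \<and> \<phi> 0 0 \<in> closure F \<union> D \<and>
     (\<forall>j. locally_abs_continuous_on (time_slice E j) (\<lambda>t. \<phi> t j)) \<and>
     (\<forall>j. \<forall>t \<in> interior (time_slice E j). \<phi> t j \<in> F) \<and>
     (\<forall>j. AE t in lebesgue. t \<in> interior (time_slice E j) \<longrightarrow>
             ((\<lambda>s. \<phi> s j) has_vector_derivative h (\<phi> t j)) (at t)) \<and>
     (\<forall>t j. (t, j) \<in> E \<and> (t, Suc j) \<in> E \<longrightarrow> \<phi> t j \<in> D \<and> \<phi> t (Suc j) = g (\<phi> t j))"

definition maximal_solution ::
  "'x::euclidean_space set \<Rightarrow> ('x \<Rightarrow> 'x) \<Rightarrow> 'x set \<Rightarrow> ('x \<Rightarrow> 'x)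
    \<Rightarrow> (real \<times> nat) set \<Rightarrow> (real \<Rightarrow> nat \<Rightarrow> 'x) \<Rightarrow> bool" where
  "maximal_solution F h D g E \<phi> \<longleftrightarrow>
     hybrid_solution F h D g E \<phi> \<and>
     \<not> (\<exists>E' \<phi>'. hybrid_solution F h D g E' \<phi>' \<and> E \<subset> E' \<and> (\<forall>(t, j) \<in> E. \<phi> t j = \<phi>' t j))"

section \<open>Asymptotic stability\<close>

definition inflate :: "'x::real_normed_vector set \<Rightarrow> real \<Rightarrow> 'x set" where
  "inflate K \<epsilon> = (\<Union>y\<in>K. cball y \<epsilon>)"

definition complete_domain :: "(real \<times> nat) set \<Rightarrow> bool" where
  "complete_domain E \<longleftrightarrow> (\<forall>M. \<exists>(t, j) \<in> E. t + real j > M)"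

text \<open>Both properties concern all maximal solutions, so this is the global notion.\<close>

definition asymptotically_stable ::
  "'x::euclidean_space set \<Rightarrow> ('x \<Rightarrow> 'x) \<Rightarrow> 'x set \<Rightarrow> ('x \<Rightarrow> 'x) \<Rightarrow> 'x set \<Rightarrow> bool" where
  "asymptotically_stable F h D g K \<longleftrightarrow>
     (\<forall>\<epsilon>>0. \<exists>\<delta>>0. \<forall>E \<phi>. maximal_solution F h D g E \<phi> \<and> \<phi> 0 0 \<in> inflate K \<delta> \<longrightarrow>
        (\<forall>(t, j) \<in> E. \<phi> t j \<in> inflate K \<epsilon>)) \<and>
     (\<forall>E \<phi>. maximal_solution F h D g E \<phi> \<longrightarrow>
        bounded ((\<lambda>(t, j). \<phi> t j) ` E) \<and>
        (complete_domain E \<longrightarrow>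
           (\<forall>\<epsilon>>0. \<exists>M. \<forall>(t, j) \<in> E. t + real j \<ge> M \<longrightarrow> infdist (\<phi> t j) K < \<epsilon>)))"

text \<open>The feedback \<open>\<rho>\<close> has domain \<open>state_proj U C\<close>; its values elsewhere are irrelevant.\<close>

definition renders_asymptotically_stable ::
  "'u::euclidean_space set \<Rightarrow> ('x::euclidean_space \<times> 'u) set \<Rightarrow> 'x set
    \<Rightarrow> ('x \<times> 'u \<Rightarrow> 'x) \<Rightarrow> ('x \<Rightarrow> 'x) \<Rightarrow> ('x \<Rightarrow> 'u) \<Rightarrow> 'x set \<Rightarrow> bool" where
  "renders_asymptotically_stable U C D f g \<rho> K \<longleftrightarrow>
     asymptotically_stable {x \<in> state_proj U C. (x, \<rho> x) \<in> C} (\<lambda>x. f (x, \<rho> x)) D g K"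

end

theory Submission
  imports Defs
begin

text \<open>The theorem combines two independent facts.

  Stability: whenever the feedback takes its value in the regulation map at points with \<open>V > s\<close>, where
  \<open>s = r\<close> for the sublevel set and \<open>s = 0\<close> for \<open>A\<close>, flowing above level \<open>s\<close> decreases \<open>V\<close> at the rate
  \<open>\<alpha> (infdist x A)\<close>, and every jump decreases \<open>V\<close> by at least as much.  Since flows are only controlled
  above level \<open>s\<close>, the correct invariant is a barrier: along every solution
  \<open>V (\<phi> t j) \<le> max s (V (\<phi> 0 0) - c * (t + j))\<close>, for every \<open>c \<ge> 0\<close> that bounds the decay from below
  on the part of the solution above \<open>s\<close> (\<open>hybrid_solution_lyapunov_bound\<close>).  With \<open>c = 0\<close> it
  gives stability and boundedness.  With \<open>s\<close> replaced by \<open>s + \<eta>\<close> there is such a \<open>c > 0\<close>, because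
  the solution is, as long as it is above that level, in a compact shell around \<open>A\<close> on which the
  decay rate has a positive minimum; this gives attractivity (\<open>asymptotically_stable_lyapunov\<close>).
  Whatever the feedback does where \<open>V \<le> s\<close>, a solution cannot climb back over level \<open>s\<close>; for \<open>s = 0\<close>,
  a solution that has reached \<open>A\<close> cannot leave it.  The differential equation holds only almost
  everywhere, so the barrier along flows rests on the fact that an absolutely continuous function
  whose derivative is almost everywhere at most \<open>-c\<close> decreases at rate \<open>c\<close>
  (\<open>abs_continuous_on_decrease\<close>).

  Regularity: the regulation map has closed convex values and is closed under limits wherever
  \<open>V > 0\<close>, so a minimum-norm selection is continuous as soon as its norm is upper semicontinuous, that
  is, as soon as points of the regulation map at \<open>x\<close> of almost minimal norm are limits of points of
  the map near \<open>x\<close> (\<open>min_norm_law_continuous_at\<close>).  In the second part lower semicontinuity of the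
  map says precisely this.  In the first part \<open>\<alpha> < \<alpha>3\<close> provides a control with strict decrease;
  moving the minimizer slightly towards it, which convexity allows, yields a control with strict
  decrease and almost minimal norm, and strict decrease survives small perturbations of the state
  (\<open>T_c_inner_approximation\<close>).\<close>

section \<open>Absolutely continuous functions\<close>

text \<open>Tagged divisions are indexed by themselves, not by numbers; the definition of absolute
  continuity is transferred to arbitrary finite index sets for their sake.\<close>

lemma abs_continuous_on_finite:
  assumes "abs_continuous_on I h" "\<epsilon> > 0"
  shows "\<exists>\<delta>>0. \<forall>(P :: 'i set) l u.
      finite P \<and> (\<forall>i\<in>P. l i \<le> u i \<and> {l i..u i} \<subseteq> I) \<and>
      pairwise (\<lambda>i k. disjnt {l i<..<u i} {l k<..<u k}) P \<and> (\<Sum>i\<in>P. u i - l i) < \<delta> \<longrightarrow>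
      (\<Sum>i\<in>P. norm (h (u i) - h (l i))) < \<epsilon>"
proof -
  from assms obtain \<delta> where \<delta>: "\<delta> > 0" and ac: "\<And>(n::nat) a b.
        (\<forall>k<n. a k \<le> b k \<and> {a k..b k} \<subseteq> I) \<and>
        pairwise (\<lambda>k l. disjnt {a k<..<b k} {a l<..<b l}) {..<n} \<and>
        (\<Sum>k<n. b k - a k) < \<delta> \<Longrightarrow> (\<Sum>k<n. norm (h (b k) - h (a k))) < \<epsilon>"
    unfolding abs_continuous_on_def by meson
  show ?thesis
  proof (intro exI[of _ \<delta>] conjI allI impI \<delta>, elim conjE)
    fix P :: "'i set" and l u
    assume P: "finite P" "\<forall>i\<in>P. l i \<le> u i \<and> {l i..u i} \<subseteq> I"
      "pairwise (\<lambda>i k. disjnt {l i<..<u i} {l k<..<u k}) P" "(\<Sum>i\<in>P. u i - l i) < \<delta>"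
    obtain q where q: "bij_betw q {..<card P} P"
      using ex_bij_betw_nat_finite[OF P(1)] by (auto simp: atLeast0LessThan)
    have inj: "inj_on q {..<card P}" and qP: "\<And>k. k < card P \<Longrightarrow> q k \<in> P"
      using q by (auto simp: bij_betw_def)
    have "(\<Sum>k<card P. norm (h (u (q k)) - h (l (q k)))) < \<epsilon>"
    proof (rule ac[of "card P" "l \<circ> q" "u \<circ> q", unfolded comp_def], intro conjI allI impI)
      show "pairwise (\<lambda>k la. disjnt {l (q k)<..<u (q k)} {l (q la)<..<u (q la)}) {..<card P}"
        using P(3) qP inj unfolding pairwise_def inj_on_def by blast
      show "(\<Sum>k<card P. u (q k) - l (q k)) < \<delta>"
        using P(4) sum.reindex_bij_betw[OF q, of "\<lambda>i. u i - l i"] by simp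
    qed (use P(2) qP in auto)
    then show "(\<Sum>i\<in>P. norm (h (u i) - h (l i))) < \<epsilon>"
      using sum.reindex_bij_betw[OF q, of "\<lambda>i. norm (h (u i) - h (l i))"] by simp
  qed
qed

lemma abs_continuous_on_subset:
  "abs_continuous_on I h \<Longrightarrow> J \<subseteq> I \<Longrightarrow> abs_continuous_on J h"
  unfolding abs_continuous_on_def by (meson subset_trans)

lemma abs_continuous_on_imp_continuous_on:
  fixes a b :: real
  assumes "abs_continuous_on {a..b} h"
  shows "continuous_on {a..b} h"
proof (clarsimp simp: continuous_on_iff)
  fix x \<epsilon> :: real assume x: "a \<le> x" "x \<le> b" and "\<epsilon> > 0"
  obtain \<delta> where \<delta>: "\<delta> > 0" "\<forall>(P :: unit set) l u.
      finite P \<and> (\<forall>i\<in>P. l i \<le> u i \<and> {l i..u i} \<subseteq> {a..b}) \<and>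
      pairwise (\<lambda>i k. disjnt {l i<..<u i} {l k<..<u k}) P \<and> (\<Sum>i\<in>P. u i - l i) < \<delta> \<longrightarrow>
      (\<Sum>i\<in>P. norm (h (u i) - h (l i))) < \<epsilon>"
    using abs_continuous_on_finite[OF assms \<open>\<epsilon> > 0\<close>, where 'i=unit] by (elim exE conjE)
  have "dist (h y) (h x) < \<epsilon>" if y: "y \<in> {a..b}" "dist y x < \<delta>" for y
  proof -
    have "(\<Sum>i\<in>{()}. norm (h (max x y) - h (min x y))) < \<epsilon>"
      by (rule \<delta>(2)[rule_format, of "{()}" "\<lambda>_. min x y" "\<lambda>_. max x y"])
        (use x y in \<open>auto simp: dist_real_def max_def min_def\<close>)
    then show ?thesis
      by (auto simp: dist_norm norm_minus_commute max_def min_def split: if_splits)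
  qed
  then show "\<exists>d>0. \<forall>x'\<in>{a..b}. dist x' x < d \<longrightarrow> dist (h x') (h x) < \<epsilon>"
    using \<delta>(1) by blast
qed

lemma abs_continuous_on_lipschitz_compose:
  assumes "abs_continuous_on I h" "L-lipschitz_on (h ` I) V"
  shows "abs_continuous_on I (\<lambda>t. V (h t))"
  unfolding abs_continuous_on_def
proof (intro allI impI)
  fix \<epsilon> :: real assume \<epsilon>: "\<epsilon> > 0"
  have L: "L \<ge> 0" using assms(2) by (simp add: lipschitz_on_def)
  have "\<epsilon> / (L + 1) > 0" using \<epsilon> L by simp
  with assms(1) obtain \<delta> where \<delta>: "\<delta> > 0" and ac: "\<And>(n::nat) a b.
        (\<forall>k<n. a k \<le> b k \<and> {a k..b k} \<subseteq> I) \<and>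
        pairwise (\<lambda>k l. disjnt {a k<..<b k} {a l<..<b l}) {..<n} \<and>
        (\<Sum>k<n. b k - a k) < \<delta> \<Longrightarrow> (\<Sum>k<n. norm (h (b k) - h (a k))) < \<epsilon> / (L + 1)"
    unfolding abs_continuous_on_def by meson
  show "\<exists>\<delta>>0. \<forall>(n::nat) a b.
           (\<forall>k<n. a k \<le> b k \<and> {a k..b k} \<subseteq> I) \<and>
           pairwise (\<lambda>k l. disjnt {a k<..<b k} {a l<..<b l}) {..<n} \<and>
           (\<Sum>k<n. b k - a k) < \<delta> \<longrightarrow>
           (\<Sum>k<n. norm (V (h (b k)) - V (h (a k)))) < \<epsilon>"
  proof (intro exI[of _ \<delta>] conjI allI impI \<delta>)
    fix n :: nat and a b
    assume H: "(\<forall>k<n. a k \<le> b k \<and> {a k..b k} \<subseteq> I) \<and>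
        pairwise (\<lambda>k l. disjnt {a k<..<b k} {a l<..<b l}) {..<n} \<and>
        (\<Sum>k<n. b k - a k) < \<delta>"
    have "norm (V (h (b k)) - V (h (a k))) \<le> L * norm (h (b k) - h (a k))" if "k < n" for k
    proof -
      have "a k \<le> b k" "{a k..b k} \<subseteq> I" using H that by blast+
      then have "a k \<in> I" "b k \<in> I" by auto
      then show ?thesis using lipschitz_onD[OF assms(2), of "h (b k)" "h (a k)"]
        by (simp add: dist_norm)
    qed
    then have "(\<Sum>k<n. norm (V (h (b k)) - V (h (a k)))) \<le> (\<Sum>k<n. L * norm (h (b k) - h (a k)))"
      by (intro sum_mono) auto
    also have "\<dots> \<le> (L + 1) * (\<Sum>k<n. norm (h (b k) - h (a k)))"
      unfolding sum_distrib_left by (intro sum_mono mult_right_mono) auto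
    also have "\<dots> < (L + 1) * (\<epsilon> / (L + 1))"
      using ac[OF H] L by (intro mult_strict_left_mono) auto
    finally show "(\<Sum>k<n. norm (V (h (b k)) - V (h (a k)))) < \<epsilon>" using L by simp
  qed
qed

text \<open>The derivative bound fails only on a null set \<open>N\<close>, but a continuous function may well increase
  on a null set; absolute continuity excludes that.  Cover \<open>N\<close> by an open set of small measure and
  take a tagged division that is fine for a gauge which keeps intervals tagged in \<open>N\<close> inside
  that open set and makes the difference quotient at most \<open>-c + \<epsilon>\<close> on the others.  The former have
  small total length, hence contribute little by absolute continuity; the latter give the rate.\<close>

lemma abs_continuous_on_decrease:
  fixes w :: "real \<Rightarrow> real"
  assumes ab: "a \<le> b" and ac: "abs_continuous_on {a..b} w"
    and der: "AE t in lebesgue. t \<in> {a<..<b} \<longrightarrow> (\<exists>d\<le>-c. (w has_real_derivative d) (at t))"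
  shows "w b \<le> w a - c * (b - a)"
proof -
  \<comment> \<open>The endpoints are tags of the division at which nothing is known about the derivative.\<close>
  define N where "N = {t. \<not> (t \<in> {a<..<b} \<longrightarrow> (\<exists>d\<le>-c. (w has_real_derivative d) (at t)))} \<union> {a, b}"
  have "negligible {t. \<not> (t \<in> {a<..<b} \<longrightarrow> (\<exists>d\<le>-c. (w has_real_derivative d) (at t)))}"
    using der by (simp add: completion.AE_iff_null_sets negligible_iff_null_sets del: not_imp)
  then have N: "negligible N" unfolding N_def by (intro negligible_Un) auto
  have main: "w b - w a + c * (b - a) \<le> \<epsilon> * (b - a + 1 + \<bar>c\<bar>)" if \<epsilon>: "\<epsilon> > 0" for \<epsilon>
  proof -
    obtain \<delta> where \<delta>: "\<delta> > 0" and acD: "\<forall>(P :: (real \<times> real set) set) l u.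
      finite P \<and> (\<forall>i\<in>P. l i \<le> u i \<and> {l i..u i} \<subseteq> {a..b}) \<and>
      pairwise (\<lambda>i k. disjnt {l i<..<u i} {l k<..<u k}) P \<and> (\<Sum>i\<in>P. u i - l i) < \<delta> \<longrightarrow>
      (\<Sum>i\<in>P. norm (w (u i) - w (l i))) < \<epsilon>"
      using abs_continuous_on_finite[OF ac \<epsilon>, where 'i="real \<times> real set"] by (elim exE conjE)
    obtain O1 where O1: "open O1" "N \<subseteq> O1" "O1 - N \<in> lmeasurable"
        "emeasure lebesgue (O1 - N) < ennreal (min \<delta> \<epsilon>)"
      using sets_lebesgue_outer_open[of N "min \<delta> \<epsilon>"] N \<delta> \<epsilon> negligible_imp_sets
      by (metis min_less_iff_conj)
    have O1m: "O1 \<in> lmeasurable"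
      using fmeasurable.Un[OF O1(3) negligible_imp_measurable[OF N]] O1(2)
      by (simp add: Un_absorb1 Un_commute)
    have "measure lebesgue O1 = measure lebesgue (O1 - N)"
      using N O1m by (simp add: measure_Diff_null_set negligible_iff_null_sets fmeasurableD)
    also have "\<dots> < min \<delta> \<epsilon>"
      using O1(3,4) \<delta> \<epsilon> by (simp add: emeasure_eq_measure2 ennreal_less_iff)
    finally have O1_small: "measure lebesgue O1 < min \<delta> \<epsilon>" .
    \<comment> \<open>A straddling estimate: the difference quotient over any small interval around \<open>t\<close> is
    controlled, though \<open>t\<close> need not be one of its endpoints.\<close>
    have "\<exists>r>0. (t \<in> N \<longrightarrow> ball t r \<subseteq> O1) \<and>
        (t \<in> {a..b} - N \<longrightarrow> (\<forall>u v. u \<le> t \<and> t \<le> v \<and> u \<in> ball t r \<and> v \<in> ball t r \<longrightarrow>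
            w v - w u \<le> (\<epsilon> - c) * (v - u)))" for t
    proof (cases "t \<in> N")
      case True
      then show ?thesis using O1(1,2) by (auto dest: openE)
    next
      case False
      show ?thesis
      proof (cases "t \<in> {a..b}")
        case True
        with False obtain d where d: "d \<le> -c" "(w has_real_derivative d) (at t)"
          unfolding N_def by auto
        then have "\<exists>r>0. \<forall>y. norm (y - t) < r \<longrightarrow> norm (w y - w t - d * (y - t)) \<le> \<epsilon> * norm (y - t)"
          using \<epsilon> unfolding has_field_derivative_def has_derivative_at_alt by blast
        then obtain r where r: "r > 0"
          "\<And>y. \<bar>y - t\<bar> < r \<Longrightarrow> \<bar>w y - w t - d * (y - t)\<bar> \<le> \<epsilon> * \<bar>y - t\<bar>"
          by auto
        have "w v - w u \<le> (\<epsilon> - c) * (v - u)"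
          if "u \<le> t" "t \<le> v" "u \<in> ball t r" "v \<in> ball t r" for u v
        proof -
          have "w v - w t \<le> d * (v - t) + \<epsilon> * (v - t)"
            using r(2)[of v] that by (auto simp: dist_real_def abs_minus_commute)
          moreover have "w t - w u \<le> d * (t - u) + \<epsilon> * (t - u)"
            using r(2)[of u] that by (auto simp: dist_real_def abs_le_iff algebra_simps)
          ultimately have "w v - w u \<le> d * (v - u) + \<epsilon> * (v - u)" by (simp add: algebra_simps)
          moreover have "d * (v - u) \<le> (- c) * (v - u)"
            using d(1) that by (intro mult_right_mono) auto
          ultimately show ?thesis by (simp add: algebra_simps)
        qed
        then show ?thesis using r(1) False by blast
      next
        case out: False
        then show ?thesis using False by (intro exI[of _ 1]) auto
      qed
    qed
    then obtain \<rho> where \<rho>: "\<And>t. \<rho> t > 0" "\<And>t. t \<in> N \<Longrightarrow> ball t (\<rho> t) \<subseteq> O1"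
      "\<And>t u v. \<lbrakk>t \<in> {a..b} - N; u \<le> t; t \<le> v; u \<in> ball t (\<rho> t); v \<in> ball t (\<rho> t)\<rbrakk> \<Longrightarrow>
          w v - w u \<le> (\<epsilon> - c) * (v - u)"
      by metis
    have "gauge (\<lambda>t. ball t (\<rho> t))" using \<rho>(1) by (auto simp: gauge_def)
    then obtain p where p: "p tagged_division_of {a..b}" "(\<lambda>t. ball t (\<rho> t)) fine p"
      by (rule fine_division_exists_real)
    have fin: "finite p" using p(1) by blast
    have K: "x \<in> K \<and> K \<subseteq> {a..b} \<and> K \<subseteq> ball x (\<rho> x) \<and> {Inf K..Sup K} = K \<and> interior K = {Inf K<..<Sup K} \<and> Inf K \<le> x \<and> x \<le> Sup K"
      if "(x, K) \<in> p" for x K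
    proof -
      obtain u v where uv: "K = cbox u v" using p(1) \<open>(x, K) \<in> p\<close> by blast
      moreover have "x \<in> K" "K \<subseteq> {a..b}" using p(1) \<open>(x, K) \<in> p\<close> by blast+
      moreover have "K \<subseteq> ball x (\<rho> x)" using p(2) \<open>(x, K) \<in> p\<close> by (auto simp: fine_def)
      ultimately show ?thesis by auto
    qed
    define dw where "dw = (\<lambda>i::real \<times> real set. w (Sup (snd i)) - w (Inf (snd i)) + c * (Sup (snd i) - Inf (snd i)))"
    define len where "len = (\<lambda>i::real \<times> real set. Sup (snd i) - Inf (snd i))"
    define P where "P = {i \<in> p. fst i \<in> N}"
    have PK: "Inf (snd i) \<le> Sup (snd i) \<and> {Inf (snd i)..Sup (snd i)} \<subseteq> {a..b}" if "i \<in> p" for i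
      using K[of "fst i" "snd i"] that by auto
    have disj: "pairwise (\<lambda>i k. disjnt {Inf (snd i)<..<Sup (snd i)} {Inf (snd k)<..<Sup (snd k)}) p"
    proof (rule pairwiseI)
      fix i k assume H: "i \<in> p" "k \<in> p" "i \<noteq> k"
      then have "interior (snd i) \<inter> interior (snd k) = {}"
        using tagged_division_ofD(5)[OF p(1), of "fst i" "snd i" "fst k" "snd k"] by simp
      then show "disjnt {Inf (snd i)<..<Sup (snd i)} {Inf (snd k)<..<Sup (snd k)}"
        using K[of "fst i" "snd i"] K[of "fst k" "snd k"] H by (simp add: disjnt_def)
    qed
    have "(\<Sum>i\<in>P. len i) = (\<Sum>i\<in>P. measure lebesgue {Inf (snd i)<..<Sup (snd i)})"
      using PK by (intro sum.cong) (auto simp: len_def P_def)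
    also have "\<dots> = measure lebesgue (\<Union>i\<in>P. {Inf (snd i)<..<Sup (snd i)})"
    proof (rule measure_finite_Union[symmetric])
      show "disjoint_family_on (\<lambda>i. {Inf (snd i)<..<Sup (snd i)}) P"
        using disj unfolding P_def pairwise_def disjoint_family_on_def disjnt_def by blast
    qed (use fin PK in \<open>auto simp: P_def\<close>)
    also have "\<dots> \<le> measure lebesgue O1"
    proof (rule measure_mono_fmeasurable[OF _ _ O1m])
      show "(\<Union>i\<in>P. {Inf (snd i)<..<Sup (snd i)}) \<subseteq> O1"
      proof (clarsimp simp: P_def)
        fix x K t assume H: "(x, K) \<in> p" "x \<in> N" "Inf K < t" "t < Sup K"
        then have "t \<in> {Inf K..Sup K}" by simp
        then have "t \<in> K" using K[OF H(1)] by blast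
        then show "t \<in> O1" using K[OF H(1)] \<rho>(2)[OF H(2)] by blast
      qed
    qed (use fin in \<open>auto simp: P_def intro!: sets.finite_UN\<close>)
    finally have lenP: "(\<Sum>i\<in>P. len i) < min \<delta> \<epsilon>" using O1_small by simp
    have "(\<Sum>i\<in>P. norm (w (Sup (snd i)) - w (Inf (snd i)))) < \<epsilon>"
      using fin PK disj lenP
      by (intro acD[rule_format] conjI) (auto simp: P_def len_def pairwise_def)
    moreover have "(\<Sum>i\<in>P. dw i) \<le> (\<Sum>i\<in>P. norm (w (Sup (snd i)) - w (Inf (snd i))) + \<bar>c\<bar> * len i)"
    proof (rule sum_mono)
      fix i assume "i \<in> P"
      then have "0 \<le> len i" using PK[of i] by (auto simp: len_def P_def)
      then have "c * len i \<le> \<bar>c\<bar> * len i" by (simp add: mult_right_mono)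
      then show "dw i \<le> norm (w (Sup (snd i)) - w (Inf (snd i))) + \<bar>c\<bar> * len i"
        unfolding dw_def len_def by simp
    qed
    moreover have "\<bar>c\<bar> * (\<Sum>i\<in>P. len i) \<le> \<bar>c\<bar> * \<epsilon>"
      using lenP by (intro mult_left_mono) auto
    ultimately have bad: "(\<Sum>i\<in>P. dw i) \<le> \<epsilon> * (1 + \<bar>c\<bar>)"
      by (simp add: sum.distrib sum_distrib_left[symmetric] algebra_simps)
    have "dw i \<le> \<epsilon> * len i" if "i \<in> p - P" for i
    proof -
      obtain x L where i: "i = (x, L)" by (cases i)
      have L: "(x, L) \<in> p" "x \<notin> N" using that i by (auto simp: P_def)
      note KL = K[OF L(1)]
      have "Inf L \<in> {Inf L..Sup L}" "Sup L \<in> {Inf L..Sup L}" using KL by auto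
      then have "Inf L \<in> L" "Sup L \<in> L" using KL by blast+
      then have "w (Sup L) - w (Inf L) \<le> (\<epsilon> - c) * (Sup L - Inf L)"
        using KL L(2) by (intro \<rho>(3)[of x]) blast+
      then show ?thesis by (simp add: i dw_def len_def algebra_simps)
    qed
    then have "(\<Sum>i\<in>p - P. dw i) \<le> (\<Sum>i\<in>p - P. \<epsilon> * len i)" by (intro sum_mono)
    also have "\<dots> \<le> (\<Sum>i\<in>p. \<epsilon> * len i)"
      using fin PK \<epsilon> by (intro sum_mono2) (auto simp: len_def)
    also have "\<dots> = \<epsilon> * (b - a)"
      using additive_tagged_division_1[OF ab p(1), of "\<lambda>x. x"]
      by (simp add: sum_distrib_left[symmetric] len_def case_prod_unfold)
    finally have good: "(\<Sum>i\<in>p - P. dw i) \<le> \<epsilon> * (b - a)" .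
    have "w b - w a + c * (b - a) = (\<Sum>i\<in>p. dw i)"
      using additive_tagged_division_1[OF ab p(1), of "\<lambda>x. w x + c * x"]
      by (simp add: dw_def case_prod_unfold algebra_simps)
    also have "\<dots> = (\<Sum>i\<in>P. dw i) + (\<Sum>i\<in>p - P. dw i)"
      using sum.subset_diff[of P p dw] fin by (auto simp: P_def)
    finally show ?thesis using good bad by (simp add: algebra_simps)
  qed
  have "w b - w a + c * (b - a) \<le> 0"
  proof (rule field_le_epsilon)
    fix e :: real assume e: "e > 0"
    have M: "b - a + 1 + \<bar>c\<bar> > 0" using ab by linarith
    then have "e / (b - a + 1 + \<bar>c\<bar>) > 0" using e by simp
    from main[OF this] show "w b - w a + c * (b - a) \<le> 0 + e" using M by simp
  qed
  then show ?thesis by simp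
qed

text \<open>After the last time at which \<open>w \<le> s\<close>, the function is nonincreasing and hence stays below \<open>s\<close>;
  if there is no such time, it decreases at rate \<open>c\<close> throughout.\<close>

lemma abs_continuous_on_barrier:
  fixes w :: "real \<Rightarrow> real"
  assumes ab: "a \<le> b" and ac: "abs_continuous_on {a..b} w" and c: "c \<ge> 0"
    and der: "AE t in lebesgue. t \<in> {a<..<b} \<and> s < w t \<longrightarrow>
        (\<exists>d\<le>-c. (w has_real_derivative d) (at t))"
  shows "w b \<le> max s (w a - c * (b - a))"
proof (cases "\<exists>t\<in>{a..b}. w t \<le> s")
  case False
  then have "AE t in lebesgue. t \<in> {a<..<b} \<longrightarrow> (\<exists>d\<le>-c. (w has_real_derivative d) (at t))"
    using der by (auto simp: not_le elim!: eventually_mono)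
  then have "w b \<le> w a - c * (b - a)"
    by (rule abs_continuous_on_decrease[OF ab ac])
  then show ?thesis by simp
next
  case True
  define S where "S = {t\<in>{a..b}. w t \<le> s}"
  have "closed S"
    using continuous_closed_preimage[OF abs_continuous_on_imp_continuous_on[OF ac], of "{..s}"]
    by (simp add: S_def vimage_def Int_def)
  have "\<exists>\<tau>\<in>S. \<forall>t\<in>S. t \<le> \<tau>"
  proof (rule compact_attains_sup)
    have "S = {a..b} \<inter> S" by (auto simp: S_def)
    then show "compact S" using \<open>closed S\<close> by (metis compact_Int_closed compact_Icc)
  qed (use True in \<open>auto simp: S_def\<close>)
  then obtain \<tau> where \<tau>: "\<tau> \<in> {a..b}" "w \<tau> \<le> s" "\<And>t. t \<in> {a..b} \<Longrightarrow> w t \<le> s \<Longrightarrow> t \<le> \<tau>"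
    unfolding S_def by blast
  have "AE t in lebesgue. t \<in> {\<tau><..<b} \<longrightarrow> (\<exists>d\<le>-0. (w has_real_derivative d) (at t))"
    using der
  proof (rule AE_mp, intro AE_I2 impI)
    fix t assume H: "t \<in> {a<..<b} \<and> s < w t \<longrightarrow> (\<exists>d\<le>-c. (w has_real_derivative d) (at t))"
      and t: "t \<in> {\<tau><..<b}"
    have "s < w t" using \<tau>(1) \<tau>(3)[of t] t by (auto simp: not_le[symmetric])
    moreover have "t \<in> {a<..<b}" using t \<tau>(1) by auto
    ultimately obtain d where "d \<le> -c" "(w has_real_derivative d) (at t)" using H by blast
    then show "\<exists>d\<le>-0. (w has_real_derivative d) (at t)" using c by (intro exI[of _ d]) auto
  qed
  moreover have "abs_continuous_on {\<tau>..b} w"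
    using ac by (rule abs_continuous_on_subset) (use \<tau>(1) in auto)
  ultimately have "w b \<le> w \<tau>"
    using abs_continuous_on_decrease[of \<tau> b w 0] \<tau>(1) by simp
  then show ?thesis using \<tau>(2) by simp
qed

section \<open>Continuously differentiable functions along absolutely continuous curves\<close>

lemma grad_eq:
  fixes V :: "'x::real_inner \<Rightarrow> real"
  assumes "GDERIV V x :> d" shows "grad V x = d"
  unfolding grad_def
proof (rule the_equality)
  show "GDERIV V x :> d" by (rule assms)
next
  fix d' assume "GDERIV V x :> d'"
  then have "(\<lambda>h. h \<bullet> d') = (\<lambda>h. h \<bullet> d)"
    using assms has_derivative_unique unfolding gderiv_def by blast
  then have "(d' - d) \<bullet> d' = (d' - d) \<bullet> d" by (rule fun_cong)
  then have "(d' - d) \<bullet> (d' - d) = 0" by (simp add: inner_diff_right)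
  then show "d' = d" by simp
qed

lemma C1_on_has_derivative:
  assumes "C1_on W V" "x \<in> W"
  shows "(V has_derivative (\<lambda>h. h \<bullet> grad V x)) (at x)"
  using assms grad_eq unfolding C1_on_def gderiv_def by metis

lemma C1_on_compose_has_real_derivative:
  assumes "C1_on W V" "\<phi> t \<in> W" "(\<phi> has_vector_derivative v) (at t)"
  shows "((\<lambda>t. V (\<phi> t)) has_real_derivative grad V (\<phi> t) \<bullet> v) (at t)"
  using has_derivative_compose[OF assms(3)[unfolded has_vector_derivative_def]
      C1_on_has_derivative[OF assms(1,2)]]
  by (simp add: has_field_derivative_def inner_commute mult_commute_abs)

text \<open>Needed to carry absolute continuity over from a solution to \<open>V\<close> along the solution.  The
  gradient is bounded on small balls, and a locally Lipschitz function is Lipschitz on compact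
  sets.\<close>

lemma C1_on_lipschitz_compact:
  fixes V :: "'x::euclidean_space \<Rightarrow> real"
  assumes "C1_on W V" "open W" "compact K" "K \<subseteq> W"
  obtains L where "L-lipschitz_on K V"
proof -
  have "local_lipschitz (UNIV :: real set) K (\<lambda>_. V)"
  proof (rule local_lipschitzI)
    fix t :: real and x assume "x \<in> K"
    then have "x \<in> W" using assms(4) by blast
    then obtain u where u: "u > 0" "cball x u \<subseteq> W"
      using open_contains_cball_eq[OF assms(2)] by metis
    have "continuous_on (cball x u) (grad V)"
      using assms(1) unfolding C1_on_def by (intro continuous_on_subset[OF _ u(2)]) simp
    then have "bounded (grad V ` cball x u)"
      by (intro compact_imp_bounded compact_continuous_image compact_cball)
    then obtain B where B: "B > 0" "\<And>y. y \<in> cball x u \<Longrightarrow> norm (grad V y) \<le> B"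
      unfolding bounded_pos by auto
    have "B-lipschitz_on (cball x u) V"
    proof (rule lipschitz_onI)
      fix y z assume yz: "y \<in> cball x u" "z \<in> cball x u"
      have "norm (V z - V y) \<le> B * norm (z - y)"
      proof (rule differentiable_bound[OF convex_cball _ _ yz(2,1)])
        fix w assume w: "w \<in> cball x u"
        show "(V has_derivative (\<lambda>h. h \<bullet> grad V w)) (at w within cball x u)"
          using C1_on_has_derivative[OF assms(1) subsetD[OF u(2) w]] by (rule has_derivative_at_withinI)
        have "norm (h \<bullet> grad V w) \<le> B * norm h" for h
          using Cauchy_Schwarz_ineq2[of h "grad V w"] mult_left_mono[OF B(2)[OF w] norm_ge_zero[of h]]
          by (simp add: mult.commute)
        then show "onorm (\<lambda>h. h \<bullet> grad V w) \<le> B" by (rule onorm_le)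
      qed
      then show "dist (V y) (V z) \<le> B * dist y z" by (simp add: dist_norm norm_minus_commute)
    qed (use B in simp)
    then have "B-lipschitz_on (cball x u \<inter> K) V" by (rule lipschitz_on_subset) auto
    then show "\<exists>u>0. \<exists>L. \<forall>t\<in>cball t u \<inter> UNIV. L-lipschitz_on (cball x u \<inter> K) V"
      using u(1) by blast
  qed
  then have "local_lipschitz {0::real} K (\<lambda>_. V)" by (rule local_lipschitz_subset) auto
  then show thesis
    using that local_lipschitz_compact_implies_lipschitz[OF _ assms(3), of "{0::real}" "\<lambda>_. V"] by auto
qed

section \<open>Lyapunov functions along hybrid solutions\<close>

text \<open>A hybrid time \<open>(T, J)\<close> is reached from \<open>(0, 0)\<close> by finitely many flow intervals and jumps, so a
  property that persists along both holds at \<open>(T, J)\<close>.\<close>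

lemma hybrid_time_domain_induct [consumes 2, case_names init flow jump]:
  assumes E: "hybrid_time_domain E" and TJ: "(T, J) \<in> E"
    and init: "P 0 0"
    and flow: "\<And>a b j. \<lbrakk>a \<le> b; {a..b} \<subseteq> time_slice E j; P a j\<rbrakk> \<Longrightarrow> P b j"
    and jump: "\<And>t j. \<lbrakk>(t, j) \<in> E; (t, Suc j) \<in> E; P t j\<rbrakk> \<Longrightarrow> P t (Suc j)"
  shows "P T J"
proof -
  have "\<forall>(T, J) \<in> E. \<exists>N (t :: nat \<Rightarrow> real). t 0 = 0 \<and> (\<forall>j<N. t j \<le> t (Suc j)) \<and>
        E \<inter> ({0..T} \<times> {0..J}) = (\<Union>j<N. {t j..t (Suc j)} \<times> {j})"
    using E unfolding hybrid_time_domain_def by (rule conjunct2)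
  from bspec[OF this TJ] obtain N t where t: "t 0 = 0" "\<forall>j<N. t j \<le> t (Suc j)"
    and eq: "E \<inter> ({0..T} \<times> {0..J}) = (\<Union>j<N. {t j..t (Suc j)} \<times> {j})"
    unfolding prod.case by (elim exE conjE)
  have "T \<ge> 0" using E TJ unfolding hybrid_time_domain_def by auto
  then have "(T, J) \<in> (\<Union>j<N. {t j..t (Suc j)} \<times> {j})"
    using TJ unfolding eq[symmetric] by simp
  then have JN: "J < N" and T: "T \<in> {t J..t (Suc J)}" by auto
  have sub: "(\<Union>j<N. {t j..t (Suc j)} \<times> {j}) \<subseteq> E" unfolding eq[symmetric] by blast
  have slice: "{t j..t (Suc j)} \<subseteq> time_slice E j" if "j < N" for j
    using sub that by (auto simp: time_slice_def)
  have ends: "(t j, j) \<in> E" "(t (Suc j), j) \<in> E" if "j < N" for j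
    using subsetD[OF slice[OF that], of "t j"] subsetD[OF slice[OF that], of "t (Suc j)"] t(2) that
    by (auto simp: time_slice_def)
  have start: "P (t j) j" if "j < N" for j
    using that
  proof (induction j)
    case 0
    then show ?case using init t(1) by simp
  next
    case (Suc j)
    then have "P (t (Suc j)) j"
      using flow[OF _ slice] t(2) Suc_lessD by blast
    then show ?case using jump ends Suc.prems by (meson Suc_lessD)
  qed
  show ?thesis
    by (rule flow[OF _ _ start[OF JN]]) (use T slice[OF JN] in auto)
qed

text \<open>Membership in \<open>F\<close> is only required at interior times; continuity extends it to the endpoints,
  at the price of a closure.\<close>

lemma hybrid_solution_flow_in_closure:
  assumes sol: "hybrid_solution F h D g E \<phi>" and ab: "a < b" "{a..b} \<subseteq> time_slice E j"
    and t: "t \<in> {a..b}"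
  shows "\<phi> t j \<in> closure F"
proof -
  have "locally_abs_continuous_on (time_slice E j) (\<lambda>t. \<phi> t j)"
    using sol unfolding hybrid_solution_def by blast
  then have "continuous_on {a..b} (\<lambda>t. \<phi> t j)"
    using ab(2) abs_continuous_on_imp_continuous_on unfolding locally_abs_continuous_on_def by blast
  moreover have cl: "closure {a<..<b} = {a..b}" using ab(1) by simp
  moreover have "{a<..<b} \<subseteq> interior (time_slice E j)"
    using ab(2) by (intro interior_maximal) auto
  then have "(\<lambda>t. \<phi> t j) ` {a<..<b} \<subseteq> closure F"
    using sol closure_subset unfolding hybrid_solution_def by blast
  ultimately have "(\<lambda>t. \<phi> t j) ` closure {a<..<b} \<subseteq> closure F"
    by (intro image_closure_subset) auto
  then show ?thesis using t cl by blast
qed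

lemma hybrid_solution_range:
  assumes sol: "hybrid_solution F h D g E \<phi>" and "(T, J) \<in> E"
  shows "\<phi> T J \<in> closure F \<union> D \<union> g ` D"
proof -
  have E: "hybrid_time_domain E" using sol unfolding hybrid_solution_def by blast
  from E assms(2) show ?thesis
  proof (induction rule: hybrid_time_domain_induct)
    case init
    then show ?case using sol unfolding hybrid_solution_def by blast
  next
    case (flow a b j)
    then show ?case
      using hybrid_solution_flow_in_closure[OF sol, of a b j b] by (cases "a = b") auto
  next
    case (jump t j)
    then show ?case using sol unfolding hybrid_solution_def by blast
  qed
qed

text \<open>The rate and jump conditions are imposed along the solution only, not on all of \<open>F\<close> and \<open>D\<close>: a
  positive \<open>c\<close> is available only once the solution is known to be bounded, which in turn follows
  from the case \<open>c = 0\<close>.\<close>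

lemma hybrid_solution_lyapunov_bound:
  fixes V :: "'x::euclidean_space \<Rightarrow> real"
  assumes sol: "hybrid_solution F h D g E \<phi>"
    and W: "open W" "closure F \<subseteq> W" "C1_on W V"
    and c: "c \<ge> 0"
    and flow_rate: "\<And>t j. \<lbrakk>t \<in> interior (time_slice E j); s < V (\<phi> t j)\<rbrakk> \<Longrightarrow>
        grad V (\<phi> t j) \<bullet> h (\<phi> t j) \<le> - c"
    and jump_rate: "\<And>t j. \<lbrakk>(t, j) \<in> E; (t, Suc j) \<in> E; s < V (\<phi> t j)\<rbrakk> \<Longrightarrow>
        V (\<phi> t (Suc j)) \<le> V (\<phi> t j) - c"
    and jump_stay: "\<And>t j. \<lbrakk>(t, j) \<in> E; (t, Suc j) \<in> E; V (\<phi> t j) \<le> s\<rbrakk> \<Longrightarrow> V (\<phi> t (Suc j)) \<le> s"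
    and TJ: "(T, J) \<in> E"
  shows "V (\<phi> T J) \<le> max s (V (\<phi> 0 0) - c * (T + real J))"
proof -
  have E: "hybrid_time_domain E" using sol unfolding hybrid_solution_def by blast
  from E TJ show ?thesis
  proof (induction rule: hybrid_time_domain_induct)
    case init
    then show ?case by simp
  next
    case (jump t j)
    show ?case
    proof (cases "V (\<phi> t j) \<le> s")
      case True
      then show ?thesis using jump_stay[OF jump(1,2)] by simp
    next
      case False
      then have "V (\<phi> t (Suc j)) \<le> V (\<phi> t j) - c" using jump_rate[OF jump(1,2)] by simp
      moreover have "V (\<phi> t j) \<le> V (\<phi> 0 0) - c * (t + real j)" using jump(3) False by simp
      ultimately show ?thesis by (simp add: algebra_simps)
    qed
  next
    case (flow a b j)
    show ?case
    proof (cases "a = b")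
      case True
      then show ?thesis using flow by simp
    next
      case False
      then have ab: "a < b" using flow by simp
      have ac: "abs_continuous_on {a..b} (\<lambda>t. \<phi> t j)"
        using sol flow(2) unfolding hybrid_solution_def locally_abs_continuous_on_def by blast
      have in_W: "(\<lambda>t. \<phi> t j) ` {a..b} \<subseteq> W"
        using hybrid_solution_flow_in_closure[OF sol ab flow(2)] W(2) by blast
      have "compact ((\<lambda>t. \<phi> t j) ` {a..b})"
        using abs_continuous_on_imp_continuous_on[OF ac] by (intro compact_continuous_image) auto
      then obtain L where "L-lipschitz_on ((\<lambda>t. \<phi> t j) ` {a..b}) V"
        using C1_on_lipschitz_compact[OF W(3,1) _ in_W] by blast
      then have acV: "abs_continuous_on {a..b} (\<lambda>t. V (\<phi> t j))"
        by (rule abs_continuous_on_lipschitz_compose[OF ac])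
      have int: "{a<..<b} \<subseteq> interior (time_slice E j)"
        using flow(2) by (intro interior_maximal) auto
      have ode: "AE t in lebesgue. t \<in> interior (time_slice E j) \<longrightarrow>
             ((\<lambda>s. \<phi> s j) has_vector_derivative h (\<phi> t j)) (at t)"
        using sol unfolding hybrid_solution_def by blast
      have "AE t in lebesgue. t \<in> {a<..<b} \<and> s < V (\<phi> t j) \<longrightarrow>
          (\<exists>d\<le>-c. ((\<lambda>t. V (\<phi> t j)) has_real_derivative d) (at t))"
        using ode
      proof (rule eventually_mono, intro impI, elim conjE)
        fix t assume H: "t \<in> interior (time_slice E j) \<longrightarrow>
             ((\<lambda>s. \<phi> s j) has_vector_derivative h (\<phi> t j)) (at t)"
          and t: "t \<in> {a<..<b}" "s < V (\<phi> t j)"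
        have ti: "t \<in> interior (time_slice E j)" using int t(1) by blast
        have "\<phi> t j \<in> W" using in_W t(1) by auto
        then have "((\<lambda>t. V (\<phi> t j)) has_real_derivative grad V (\<phi> t j) \<bullet> h (\<phi> t j)) (at t)"
          using C1_on_compose_has_real_derivative[OF W(3), of "\<lambda>t. \<phi> t j"] H ti by blast
        then show "\<exists>d\<le>-c. ((\<lambda>t. V (\<phi> t j)) has_real_derivative d) (at t)"
          using flow_rate[OF ti t(2)] by blast
      qed
      then have "V (\<phi> b j) \<le> max s (V (\<phi> a j) - c * (b - a))"
        by (rule abs_continuous_on_barrier[OF less_imp_le[OF ab] acV c])
      moreover have "c * (b - a) \<ge> 0" using c ab by simp
      moreover have "V (\<phi> 0 0) - c * (b + real j) = V (\<phi> 0 0) - c * (a + real j) - c * (b - a)"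
        by (simp add: algebra_simps)
      ultimately show ?thesis using flow(3) by linarith
    qed
  qed
qed

section \<open>Asymptotic stability from decrease above a level\<close>

lemma class_K_inf_less_iff:
  assumes "class_K_inf \<alpha>" "0 \<le> x" "0 \<le> y"
  shows "\<alpha> x < \<alpha> y \<longleftrightarrow> x < y"
  using assms strict_mono_on_less[of "{0..}" \<alpha> x y] unfolding class_K_inf_def by auto

lemma class_K_inf_small:
  assumes "class_K_inf \<alpha>" "\<eta> > 0"
  obtains \<delta> where "\<delta> > 0" "\<And>x. 0 \<le> x \<Longrightarrow> x < \<delta> \<Longrightarrow> \<alpha> x < \<eta>"
proof -
  have "\<exists>d>0. \<forall>x\<in>{0..}. dist x 0 < d \<longrightarrow> dist (\<alpha> x) (\<alpha> 0) < \<eta>"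
    using assms unfolding class_K_inf_def continuous_on_iff by (metis atLeast_iff order_refl)
  then obtain d where d: "d > 0" "\<forall>x\<in>{0..}. dist x 0 < d \<longrightarrow> dist (\<alpha> x) (\<alpha> 0) < \<eta>"
    by blast
  show thesis
  proof (rule that[OF d(1)])
    fix x :: real assume "0 \<le> x" "x < d"
    then show "\<alpha> x < \<eta>" using d(2) assms(1) by (auto simp: class_K_inf_def dist_real_def)
  qed
qed

lemma positive_definite_nonneg:
  "positive_definite \<beta> \<Longrightarrow> 0 \<le> x \<Longrightarrow> 0 \<le> \<beta> x"
  unfolding positive_definite_def by (metis less_eq_real_def)

text \<open>To be read with \<open>x\<close> the distance of a state to the attractor and \<open>v\<close> the value of the Lyapunov
  function there.  The bounds by \<open>\<alpha>1\<close> and \<open>\<alpha>2\<close> confine \<open>x\<close> to a compact interval of positive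
  numbers, on which \<open>\<beta>\<close> attains a positive minimum.\<close>

lemma uniform_decay_rate:
  assumes K: "class_K_inf \<alpha>1" "class_K_inf \<alpha>2" and \<beta>: "positive_definite \<beta>" and "s > 0"
  obtains c where "c > 0"
    "\<And>v x. \<lbrakk>s \<le> v; v \<le> M; \<alpha>1 x \<le> v; v \<le> \<alpha>2 x; 0 \<le> x\<rbrakk> \<Longrightarrow> c \<le> \<beta> x"
proof -
  obtain a where a: "a > 0" "\<And>x. 0 \<le> x \<Longrightarrow> x < a \<Longrightarrow> \<alpha>2 x < s"
    using class_K_inf_small[OF K(2) \<open>s > 0\<close>] by blast
  obtain b where b: "b \<ge> 0" "\<alpha>1 b > M" using K(1) unfolding class_K_inf_def by blast
  have between: "x \<in> {a..b}" if "s \<le> v" "v \<le> M" "\<alpha>1 x \<le> v" "v \<le> \<alpha>2 x" "0 \<le> x" for v x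
    using a(2)[of x] class_K_inf_less_iff[OF K(1) that(5) b(1)] b(2) that by force
  have pos: "\<beta> x > 0" if "x \<in> {a..b}" for x using \<beta> a(1) that unfolding positive_definite_def by auto
  show thesis
  proof (cases "a \<le> b")
    case True
    have "continuous_on {a..b} \<beta>"
      using \<beta> a(1) unfolding positive_definite_def by (auto intro: continuous_on_subset)
    then obtain m where m: "m \<in> {a..b}" "\<And>x. x \<in> {a..b} \<Longrightarrow> \<beta> m \<le> \<beta> x"
      using continuous_attains_inf[of "{a..b}" \<beta>] True by auto
    show thesis by (rule that[OF pos[OF m(1)]]) (use m(2) between in blast)
  next
    case False
    then show thesis using between that[of 1] by fastforce
  qed
qed

lemma infdist_less_imp_inflate:
  assumes "infdist x K < \<epsilon>" "K \<noteq> {}" shows "x \<in> inflate K \<epsilon>"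
proof -
  have "(INF a\<in>K. dist x a) < \<epsilon>" using assms by (simp add: infdist_notempty)
  then obtain a where "a \<in> K" "dist x a < \<epsilon>" using assms(2) by (auto simp: cINF_less_iff)
  then show ?thesis by (auto simp: inflate_def dist_commute intro!: bexI[of _ a])
qed

lemma infdist_le_if_inflate: "x \<in> inflate K \<delta> \<Longrightarrow> infdist x K \<le> \<delta>"
  by (auto simp: inflate_def dist_commute intro: infdist_le2)

lemma lyapunov_bounds_closure:
  fixes V :: "'x::euclidean_space \<Rightarrow> real"
  assumes "class_K_inf \<alpha>1" "class_K_inf \<alpha>2" "continuous_on UNIV V"
    and "\<And>x. x \<in> F \<Longrightarrow> \<alpha>1 (infdist x A) \<le> V x \<and> V x \<le> \<alpha>2 (infdist x A)"
    and "x \<in> closure F"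
  shows "\<alpha>1 (infdist x A) \<le> V x \<and> V x \<le> \<alpha>2 (infdist x A)"
proof -
  have cont: "continuous_on UNIV (\<lambda>x. \<alpha> (infdist x A))" if "class_K_inf \<alpha>" for \<alpha>
    by (rule continuous_on_compose2[of "{0..}" \<alpha> UNIV "\<lambda>x. infdist x A"])
      (use that in \<open>auto simp: class_K_inf_def infdist_nonneg intro: continuous_on_infdist continuous_on_id\<close>)
  have "closed ({x. \<alpha>1 (infdist x A) \<le> V x} \<inter> {x. V x \<le> \<alpha>2 (infdist x A)})"
    using assms(3) cont[OF assms(1)] cont[OF assms(2)] by (intro closed_Int closed_Collect_le)
  then have "closure F \<subseteq> {x. \<alpha>1 (infdist x A) \<le> V x} \<inter> {x. V x \<le> \<alpha>2 (infdist x A)}"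
    by (intro closure_minimal) (use assms(4) in auto)
  then show ?thesis using assms(5) by auto
qed

text \<open>The set \<open>K\<close> enters only through \<open>near\<close> and \<open>low\<close>, which say that the values of \<open>V\<close> slightly above
  \<open>s\<close> and the neighbourhoods of \<open>K\<close> are interchangeable.  This covers both \<open>K = sublevel V s\<close> with
  \<open>s > 0\<close> and \<open>K = A\<close> with \<open>s = 0\<close>.\<close>

lemma asymptotically_stable_lyapunov:
  fixes V :: "'x::euclidean_space \<Rightarrow> real"
  assumes A: "compact A" "A \<noteq> {}"
    and W: "open W" "closure F \<subseteq> W" "C1_on W V" and V: "continuous_on UNIV V"
    and K: "class_K_inf \<alpha>1" "class_K_inf \<alpha>2"
    and bounds: "\<And>x. x \<in> F \<union> D \<union> g ` D \<Longrightarrow>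
        \<alpha>1 (infdist x A) \<le> V x \<and> V x \<le> \<alpha>2 (infdist x A)"
    and \<beta>: "positive_definite \<beta>" and s: "s \<ge> 0"
    and flow: "\<And>x. \<lbrakk>x \<in> F; s < V x\<rbrakk> \<Longrightarrow> grad V x \<bullet> h x \<le> - \<beta> (infdist x A)"
    and jump: "\<And>x. x \<in> D \<Longrightarrow> V (g x) - V x \<le> - \<beta> (infdist x A)"
    and near: "\<And>\<epsilon>. \<epsilon> > 0 \<Longrightarrow> \<exists>\<eta>>0. \<forall>x. \<alpha>1 (infdist x A) \<le> V x \<and> V x \<le> s + \<eta> \<longrightarrow> infdist x K < \<epsilon>"
    and low: "\<And>\<eta>. \<eta> > 0 \<Longrightarrow> \<exists>\<delta>>0. \<forall>x\<in>inflate K \<delta>. V x \<le> \<alpha>2 (infdist x A) \<longrightarrow> V x \<le> s + \<eta>"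
  shows "asymptotically_stable F h D g K"
proof -
  have bounds': "\<alpha>1 (infdist x A) \<le> V x \<and> V x \<le> \<alpha>2 (infdist x A)"
    if "x \<in> closure F \<union> D \<union> g ` D" for x
    using lyapunov_bounds_closure[OF K V, of F A x] bounds that by blast
  have decrease: "V (\<phi> t j) \<le> max s' (V (\<phi> 0 0) - c * (t + real j))"
    if sol: "hybrid_solution F h D g E \<phi>" and "s \<le> s'" "c \<ge> 0" and "(t, j) \<in> E"
      and c: "\<And>t j. \<lbrakk>(t, j) \<in> E; s' < V (\<phi> t j)\<rbrakk> \<Longrightarrow> c \<le> \<beta> (infdist (\<phi> t j) A)"
    for E \<phi> t j s' c
  proof (rule hybrid_solution_lyapunov_bound[OF sol W \<open>c \<ge> 0\<close> _ _ _ \<open>(t, j) \<in> E\<close>])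
    fix t j assume t: "t \<in> interior (time_slice E j)" "s' < V (\<phi> t j)"
    then have "\<phi> t j \<in> F" "(t, j) \<in> E"
      using sol interior_subset unfolding hybrid_solution_def by (auto simp: time_slice_def)
    then show "grad V (\<phi> t j) \<bullet> h (\<phi> t j) \<le> - c"
      using flow[of "\<phi> t j"] c[of t j] t(2) \<open>s \<le> s'\<close> by linarith
  next
    fix t j assume t: "(t, j) \<in> E" "(t, Suc j) \<in> E"
    then have D: "\<phi> t j \<in> D" "\<phi> t (Suc j) = g (\<phi> t j)"
      using sol unfolding hybrid_solution_def by blast+
    show "V (\<phi> t (Suc j)) \<le> V (\<phi> t j) - c" if "s' < V (\<phi> t j)"
      using jump[OF D(1)] c[OF t(1) that] D(2) by simp
    show "V (\<phi> t (Suc j)) \<le> s'" if "V (\<phi> t j) \<le> s'"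
      using jump[OF D(1)] positive_definite_nonneg[OF \<beta> infdist_nonneg, of "\<phi> t j" A] D(2) that
      by simp
  qed
  have monotone: "V (\<phi> t j) \<le> max s (V (\<phi> 0 0))"
    if "hybrid_solution F h D g E \<phi>" "(t, j) \<in> E" for E \<phi> t j
    using decrease[OF that(1) order_refl order_refl that(2)
      positive_definite_nonneg[OF \<beta> infdist_nonneg]] by simp
  note G = bounds'[OF hybrid_solution_range]
  have stable: "\<exists>\<delta>>0. \<forall>E \<phi>. maximal_solution F h D g E \<phi> \<and> \<phi> 0 0 \<in> inflate K \<delta> \<longrightarrow>
        (\<forall>(t, j) \<in> E. \<phi> t j \<in> inflate K \<epsilon>)" if "\<epsilon> > 0" for \<epsilon>
  proof -
    obtain \<eta> where \<eta>: "\<eta> > 0"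
      "\<And>x. \<alpha>1 (infdist x A) \<le> V x \<Longrightarrow> V x \<le> s + \<eta> \<Longrightarrow> infdist x K < \<epsilon>"
      using near[OF \<open>\<epsilon> > 0\<close>] by blast
    obtain \<delta> where \<delta>: "\<delta> > 0"
      "\<And>x. x \<in> inflate K \<delta> \<Longrightarrow> V x \<le> \<alpha>2 (infdist x A) \<Longrightarrow> V x \<le> s + \<eta>"
      using low[OF \<eta>(1)] by blast
    have "\<phi> t j \<in> inflate K \<epsilon>"
      if "maximal_solution F h D g E \<phi>" and start: "\<phi> 0 0 \<in> inflate K \<delta>" and tj: "(t, j) \<in> E"
      for E \<phi> t j
    proof -
      have sol: "hybrid_solution F h D g E \<phi>" using that unfolding maximal_solution_def by blast
      then have "(0, 0) \<in> E" unfolding hybrid_solution_def by blast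
      then have "V (\<phi> 0 0) \<le> s + \<eta>" using G[OF sol] \<delta>(2)[OF start] by blast
      then have "V (\<phi> t j) \<le> s + \<eta>" using monotone[OF sol tj] \<eta>(1) by simp
      then have "infdist (\<phi> t j) K < \<epsilon>" using G[OF sol tj] \<eta>(2) by blast
      moreover have "K \<noteq> {}" using start by (auto simp: inflate_def)
      ultimately show ?thesis by (rule infdist_less_imp_inflate)
    qed
    then show ?thesis using \<delta>(1) by (intro exI[of _ \<delta>]) blast
  qed
  have bound: "bounded ((\<lambda>(t, j). \<phi> t j) ` E)" if "hybrid_solution F h D g E \<phi>" for E \<phi>
  proof -
    obtain b where b: "b \<ge> 0" "\<alpha>1 b > max s (V (\<phi> 0 0))"
      using K(1) unfolding class_K_inf_def by blast
    have "infdist (\<phi> t j) A \<le> b" if tj: "(t, j) \<in> E" for t j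
      using monotone[OF \<open>hybrid_solution F h D g E \<phi>\<close> tj] G[OF \<open>hybrid_solution F h D g E \<phi>\<close> tj] b
        class_K_inf_less_iff[OF K(1) b(1) infdist_nonneg, of "\<phi> t j" A] by linarith
    then have "(\<lambda>(t, j). \<phi> t j) ` E \<subseteq> {x. infdist x A \<le> b + 1}" by force
    moreover have "compact {x. infdist x A \<le> b + 1}" using A by (intro compact_infdist_le) (use b in auto)
    ultimately show ?thesis by (meson bounded_subset compact_imp_bounded)
  qed
  have attract: "\<exists>M. \<forall>(t, j) \<in> E. t + real j \<ge> M \<longrightarrow> infdist (\<phi> t j) K < \<epsilon>"
    if sol: "hybrid_solution F h D g E \<phi>" and "\<epsilon> > 0" for E \<phi> \<epsilon>
  proof -
    obtain \<eta> where \<eta>: "\<eta> > 0"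
      "\<And>x. \<alpha>1 (infdist x A) \<le> V x \<Longrightarrow> V x \<le> s + \<eta> \<Longrightarrow> infdist x K < \<epsilon>"
      using near[OF \<open>\<epsilon> > 0\<close>] by blast
    have "s + \<eta> > 0" using s \<eta>(1) by simp
    then obtain c where c: "c > 0" "\<And>v x. \<lbrakk>s + \<eta> \<le> v; v \<le> max s (V (\<phi> 0 0)); \<alpha>1 x \<le> v; v \<le> \<alpha>2 x; 0 \<le> x\<rbrakk>
        \<Longrightarrow> c \<le> \<beta> x"
      using uniform_decay_rate[OF K \<beta>, of "s + \<eta>" "max s (V (\<phi> 0 0))"] by blast
    have "infdist (\<phi> t j) K < \<epsilon>" if tj: "(t, j) \<in> E" and M: "t + real j \<ge> (V (\<phi> 0 0) - s) / c" for t j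
    proof -
      have "V (\<phi> t j) \<le> max (s + \<eta>) (V (\<phi> 0 0) - c * (t + real j))"
      proof (rule decrease[OF sol _ _ tj])
        fix t j assume "(t, j) \<in> E" "s + \<eta> < V (\<phi> t j)"
        then show "c \<le> \<beta> (infdist (\<phi> t j) A)"
          using c(2)[of "V (\<phi> t j)" "infdist (\<phi> t j) A"] monotone[OF sol] G[OF sol] infdist_nonneg
          by (meson less_imp_le)
      qed (use \<eta>(1) c(1) in auto)
      moreover have "V (\<phi> 0 0) - c * (t + real j) \<le> s"
        using M c(1) by (simp add: field_simps)
      ultimately have "V (\<phi> t j) \<le> s + \<eta>" using \<eta>(1) by simp
      then show ?thesis using G[OF sol tj] \<eta>(2) by blast
    qed
    then show ?thesis by blast
  qed
  have sol: "hybrid_solution F h D g E \<phi>" if "maximal_solution F h D g E \<phi>" for E \<phi>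
    using that unfolding maximal_solution_def by (rule conjunct1)
  show ?thesis
    unfolding asymptotically_stable_def
    by (intro conjI allI impI stable bound[OF sol] attract[OF sol])
qed

section \<open>Minimum-norm selections\<close>

lemma bounded_unique_limit_imp_tendsto:
  fixes X :: "nat \<Rightarrow> 'a::heine_borel"
  assumes "bounded (range X)"
    and "\<And>r v. \<lbrakk>strict_mono r; (\<lambda>i. X (r i)) \<longlonglongrightarrow> v\<rbrakk> \<Longrightarrow> v = l"
  shows "X \<longlonglongrightarrow> l"
proof (rule ccontr)
  assume "\<not> X \<longlonglongrightarrow> l"
  then obtain e where e: "e > 0" "\<And>N. \<exists>n\<ge>N. dist (X n) l \<ge> e"
    unfolding lim_sequentially by (meson not_less)
  then have "infinite {n. dist (X n) l \<ge> e}"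
    unfolding infinite_nat_iff_unbounded_le by blast
  then obtain r :: "nat \<Rightarrow> nat" where r: "strict_mono r" "\<And>n. dist (X (r n)) l \<ge> e"
    using infinite_enumerate by blast
  have "bounded (range (X \<circ> r))" using assms(1) by (rule bounded_subset) auto
  then obtain v r' where r': "strict_mono r'" "((X \<circ> r) \<circ> r') \<longlonglongrightarrow> v"
    using bounded_imp_convergent_subsequence by blast
  have "v = l"
    using assms(2)[of "r \<circ> r'" v] strict_mono_o[OF r(1) r'(1)] r'(2) by (simp add: comp_def)
  then obtain n where "dist (X (r (r' n))) l < e"
    using r'(2) e(1) unfolding lim_sequentially comp_def by blast
  then show False using r(2)[of "r' n"] by simp
qed

text \<open>By \<open>approx\<close> the norm of \<open>\<rho>\<close> is upper semicontinuous at \<open>x\<close>, so along a sequence converging to \<open>x\<close> the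
  values of \<open>\<rho>\<close> are bounded and each of their limit points has norm at most \<open>norm (\<rho> x)\<close>.  By \<open>limit\<close>
  there is then only one limit point.\<close>

lemma min_norm_law_continuous_at:
  fixes \<rho> :: "'x::metric_space \<Rightarrow> 'u::euclidean_space"
  assumes min: "min_norm_law T X \<rho>"
    and approx: "\<And>y e. \<lbrakk>\<And>i. y i \<in> X; y \<longlonglongrightarrow> x; e > 0\<rbrakk> \<Longrightarrow>
        \<exists>w z. w \<longlonglongrightarrow> z \<and> norm z < norm (\<rho> x) + e \<and> (\<forall>\<^sub>F i in sequentially. w i \<in> T (y i))"
    and limit: "\<And>y v. \<lbrakk>\<And>i. y i \<in> X; y \<longlonglongrightarrow> x; (\<lambda>i. \<rho> (y i)) \<longlonglongrightarrow> v; norm v \<le> norm (\<rho> x)\<rbrakk> \<Longrightarrow>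
        v = \<rho> x"
  shows "continuous (at x within X) \<rho>"
  unfolding continuous_within_sequentially
proof (intro allI impI, elim conjE)
  fix y :: "nat \<Rightarrow> 'x" assume y: "\<forall>n. y n \<in> X" "y \<longlonglongrightarrow> x"
  have y': "y n \<in> X" for n using y(1) by blast
  have ub: "\<forall>\<^sub>F i in sequentially. norm (\<rho> (y i)) \<le> norm (\<rho> x) + e" if e: "e > 0" for e
  proof -
    obtain w z where w: "w \<longlonglongrightarrow> z" "norm z < norm (\<rho> x) + e" "\<forall>\<^sub>F i in sequentially. w i \<in> T (y i)"
      using approx[OF y' y(2) e] by (elim exE conjE)
    have "\<forall>\<^sub>F i in sequentially. norm (w i) < norm (\<rho> x) + e"
      using order_tendstoD(2)[OF tendsto_norm[OF w(1)] w(2)] .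
    with w(3) show ?thesis
    proof eventually_elim
      case (elim i)
      have "\<not> norm (w i) < norm (\<rho> (y i))"
        using min y(1) elim(1) unfolding min_norm_law_def is_arg_min_def by blast
      then show ?case using elim(2) by simp
    qed
  qed
  have "(\<lambda>i. \<rho> (y i)) \<longlonglongrightarrow> \<rho> x"
  proof (rule bounded_unique_limit_imp_tendsto)
    show "bounded (range (\<lambda>i. \<rho> (y i)))"
      using BfunI[OF ub[of 1]] by (simp only: Bseq_eq_bounded zero_less_one)
    fix r v assume r: "strict_mono (r :: nat \<Rightarrow> nat)" "(\<lambda>i. \<rho> (y (r i))) \<longlonglongrightarrow> v"
    have "norm v \<le> norm (\<rho> x) + e" if "e > 0" for e
    proof (rule tendsto_upperbound[OF tendsto_norm[OF r(2)]])
      show "\<forall>\<^sub>F i in sequentially. norm (\<rho> (y (r i))) \<le> norm (\<rho> x) + e"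
        using eventually_subseq[OF r(1) ub[OF that]] .
    qed simp
    then have "norm v \<le> norm (\<rho> x)" by (rule field_le_epsilon)
    moreover have "(\<lambda>i. y (r i)) \<longlonglongrightarrow> x" using LIMSEQ_subseq_LIMSEQ[OF y(2) r(1)] by (simp add: comp_def)
    ultimately show "v = \<rho> x" using limit[of "\<lambda>i. y (r i)" v] y(1) r(2) by blast
  qed
  then show "(\<rho> \<circ> y) \<longlonglongrightarrow> \<rho> x" by (simp add: comp_def)
qed

lemma min_norm_unique:
  fixes S :: "'u::euclidean_space set"
  assumes "convex S" "closed S" "v \<in> S" "is_arg_min norm (\<lambda>u. u \<in> S) w" "norm v \<le> norm w"
  shows "v = w"
proof -
  have w: "w \<in> S" "\<And>z. z \<in> S \<Longrightarrow> norm w \<le> norm z"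
    using assms(4) unfolding is_arg_min_def by (auto simp: not_less)
  show ?thesis
  proof (rule any_closest_point_unique[OF assms(1,2,3) w(1), of 0])
    show "\<forall>z\<in>S. dist 0 v \<le> dist 0 z" using w(2) assms(5) by (auto intro: order_trans)
    show "\<forall>z\<in>S. dist 0 w \<le> dist 0 z" using w(2) by simp
  qed
qed

lemma min_norm_exists:
  fixes S :: "'u::euclidean_space set"
  assumes "closed S" "S \<noteq> {}"
  shows "is_arg_min norm (\<lambda>u. u \<in> S) (closest_point S 0)"
  using closest_point_exists[OF assms, of 0] by (auto simp: is_arg_min_def not_less)

section \<open>The regulation maps\<close>

lemma mem_T_c_iff:
  "u \<in> T_c U C f A V \<alpha> x \<longleftrightarrow>
    (x, u) \<in> C \<and> u \<in> U \<and> grad V x \<bullet> f (x, u) + \<alpha> (infdist x A) \<le> 0"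
  by (auto simp: T_c_def input_map_def Gamma_c_def superlevel_def)

lemma T1_c_eq_T_c:
  assumes "x \<in> state_proj U C" "V x > 0"
  shows "T1_c U C f A V \<alpha> \<rho>0 x = T_c U C f A V \<alpha> x"
  using assms by (auto simp: T1_c_def S1_c_def S0_c_def T_c_def superlevel_def)

lemma T1_c_zero_level:
  assumes "\<not> V x > 0"
  shows "T1_c U C f A V \<alpha> \<rho>0 x = input_map C x \<inter> {\<rho>0 x}"
  using assms by (simp add: T1_c_def S1_c_def)

lemma closed_T_c:
  fixes f :: "'x::euclidean_space \<times> 'u::euclidean_space \<Rightarrow> 'x"
  assumes "hybrid_basic_conditions U C D f g"
  shows "closed (T_c U C f A V \<alpha> x)"
proof -
  have C: "closed C" "C \<subseteq> UNIV \<times> U" and f: "continuous_on UNIV f"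
    using assms unfolding hybrid_basic_conditions_def by auto
  have "T_c U C f A V \<alpha> x =
      Pair x -` C \<inter> {u. grad V x \<bullet> f (x, u) + \<alpha> (infdist x A) \<le> 0}"
    using C(2) by (auto simp: mem_T_c_iff)
  moreover have "closed (Pair x -` C)"
    using C(1) by (intro closed_vimage continuous_intros)
  moreover have "closed {u. grad V x \<bullet> f (x, u) + \<alpha> (infdist x A) \<le> 0}"
    by (intro closed_Collect_le continuous_intros continuous_on_compose2[OF f]) auto
  ultimately show ?thesis by (simp add: closed_Int)
qed

text \<open>\<open>Gamma_c\<close> and the derivative of \<open>V\<close> along the flow differ, as functions of the input, by a
  constant; this frees convexity of the rate for which it was assumed.\<close>

lemma convex_on_flow_derivative:
  assumes "convex_on (input_map C x) (\<lambda>u. real_of_ereal (Gamma_c C f A V \<alpha> x u r))" "r \<le> V x"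
  shows "convex_on (input_map C x) (\<lambda>u. grad V x \<bullet> f (x, u))"
proof -
  have "real_of_ereal (Gamma_c C f A V \<alpha> x u r) = grad V x \<bullet> f (x, u) + \<alpha> (infdist x A)"
    if "u \<in> input_map C x" for u
    using that assms(2) by (simp add: Gamma_c_def input_map_def superlevel_def)
  note defect = this
  have cvx: "convex (input_map C x)" using assms(1) unfolding convex_on_def by blast
  show ?thesis
    unfolding convex_on_def
  proof (intro conjI cvx ballI allI impI)
    fix v w a b assume vw: "v \<in> input_map C x" "w \<in> input_map C x"
      and ab: "0 \<le> a" "0 \<le> b" "a + b = (1 :: real)"
    have "a *\<^sub>R v + b *\<^sub>R w \<in> input_map C x" using cvx vw ab by (rule convexD)
    moreover have "a * \<alpha> (infdist x A) + b * \<alpha> (infdist x A) = \<alpha> (infdist x A)"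
      using ab(3) by (simp add: distrib_right[symmetric])
    moreover have "real_of_ereal (Gamma_c C f A V \<alpha> x (a *\<^sub>R v + b *\<^sub>R w) r)
        \<le> a * real_of_ereal (Gamma_c C f A V \<alpha> x v r) + b * real_of_ereal (Gamma_c C f A V \<alpha> x w r)"
      using assms(1) vw ab unfolding convex_on_def by blast
    ultimately show "grad V x \<bullet> f (x, a *\<^sub>R v + b *\<^sub>R w)
        \<le> a * (grad V x \<bullet> f (x, v)) + b * (grad V x \<bullet> f (x, w))"
      using vw by (simp add: defect distrib_left)
  qed
qed

lemma convex_T_c:
  assumes "C \<subseteq> UNIV \<times> U" and cvx: "convex_on (input_map C x) (\<lambda>u. grad V x \<bullet> f (x, u))"
  shows "convex (T_c U C f A V \<alpha> x)"
proof (rule convexI)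
  fix u v :: 'b and a b :: real
  assume uv: "u \<in> T_c U C f A V \<alpha> x" "v \<in> T_c U C f A V \<alpha> x" and ab: "0 \<le> a" "0 \<le> b" "a + b = 1"
  then have mem: "u \<in> input_map C x" "v \<in> input_map C x"
    and le: "grad V x \<bullet> f (x, u) \<le> - \<alpha> (infdist x A)" "grad V x \<bullet> f (x, v) \<le> - \<alpha> (infdist x A)"
    by (auto simp: mem_T_c_iff input_map_def)
  have "grad V x \<bullet> f (x, a *\<^sub>R u + b *\<^sub>R v) \<le> a * (grad V x \<bullet> f (x, u)) + b * (grad V x \<bullet> f (x, v))"
    using cvx mem ab unfolding convex_on_def by blast
  also have "\<dots> \<le> - \<alpha> (infdist x A)" by (rule convex_bound_le[OF le ab])
  finally have "grad V x \<bullet> f (x, a *\<^sub>R u + b *\<^sub>R v) + \<alpha> (infdist x A) \<le> 0" by simp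
  moreover have "a *\<^sub>R u + b *\<^sub>R v \<in> input_map C x"
    using cvx mem ab unfolding convex_on_def by (blast intro: convexD)
  ultimately show "a *\<^sub>R u + b *\<^sub>R v \<in> T_c U C f A V \<alpha> x"
    using assms(1) by (auto simp: mem_T_c_iff input_map_def)
qed

lemma decay_defect_tendsto:
  fixes V :: "'x::euclidean_space \<Rightarrow> real" and f :: "'x \<times> 'u::euclidean_space \<Rightarrow> 'x"
  assumes W: "open W" "C1_on W V" "x \<in> W" and f: "continuous_on UNIV f"
    and \<alpha>: "continuous_on {0..} \<alpha>" and y: "y \<longlonglongrightarrow> x" and u: "u \<longlonglongrightarrow> v"
  shows "(\<lambda>i. grad V (y i) \<bullet> f (y i, u i) + \<alpha> (infdist (y i) A))
           \<longlonglongrightarrow> grad V x \<bullet> f (x, v) + \<alpha> (infdist x A)"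
proof (intro tendsto_intros)
  have "isCont (grad V) x"
    using W unfolding C1_on_def by (auto simp: continuous_on_eq_continuous_at)
  then show "(\<lambda>i. grad V (y i)) \<longlonglongrightarrow> grad V x" using y by (rule isCont_tendsto_compose)
  have "isCont f (x, v)" using f by (simp add: continuous_on_eq_continuous_at)
  then show "(\<lambda>i. f (y i, u i)) \<longlonglongrightarrow> f (x, v)"
    by (rule isCont_tendsto_compose) (intro tendsto_intros y u)
  show "(\<lambda>i. \<alpha> (infdist (y i) A)) \<longlonglongrightarrow> \<alpha> (infdist x A)"
    by (rule continuous_on_tendsto_compose[OF \<alpha>])
      (auto intro!: tendsto_infdist y simp: infdist_nonneg)
qed

lemma T_c_limit:
  fixes V :: "'x::euclidean_space \<Rightarrow> real" and f :: "'x \<times> 'u::euclidean_space \<Rightarrow> 'x"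
  assumes hbc: "hybrid_basic_conditions U C D f g"
    and W: "open W" "C1_on W V" "x \<in> W" and \<alpha>: "continuous_on {0..} \<alpha>"
    and y: "y \<longlonglongrightarrow> x" and u: "u \<longlonglongrightarrow> v"
    and ev: "\<forall>\<^sub>F i in sequentially. u i \<in> T_c U C f A V \<alpha> (y i)"
  shows "v \<in> T_c U C f A V \<alpha> x"
proof -
  have C: "closed C" "C \<subseteq> UNIV \<times> U" and f: "continuous_on UNIV f"
    using hbc unfolding hybrid_basic_conditions_def by auto
  have "(\<lambda>i. (y i, u i)) \<longlonglongrightarrow> (x, v)" by (intro tendsto_intros y u)
  moreover have "\<forall>\<^sub>F i in sequentially. (y i, u i) \<in> C"
    using ev by eventually_elim (simp add: mem_T_c_iff)
  ultimately have "(x, v) \<in> C" by (intro Lim_in_closed_set[OF C(1) _ sequentially_bot])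
  moreover have "grad V x \<bullet> f (x, v) + \<alpha> (infdist x A) \<le> 0"
  proof (rule tendsto_upperbound[OF decay_defect_tendsto[OF W f \<alpha> y u]])
    show "\<forall>\<^sub>F i in sequentially. grad V (y i) \<bullet> f (y i, u i) + \<alpha> (infdist (y i) A) \<le> 0"
      using ev by eventually_elim (simp add: mem_T_c_iff)
  qed simp
  ultimately show ?thesis using C(2) by (auto simp: mem_T_c_iff)
qed

lemma clf_strict_control:
  assumes "control_lyapunov_function U C D f g A V \<alpha>3" "x \<in> state_proj U C"
    and "\<alpha> (infdist x A) < \<alpha>3 (infdist x A)"
  obtains u where "u \<in> input_map C x" "grad V x \<bullet> f (x, u) + \<alpha> (infdist x A) < 0"
proof -
  have "(INF u \<in> input_map C x. ereal (grad V x \<bullet> f (x, u))) \<le> ereal (- \<alpha>3 (infdist x A))"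
    using assms(1,2) unfolding control_lyapunov_function_def by blast
  also have "\<dots> < ereal (- \<alpha> (infdist x A))" using assms(3) by simp
  finally obtain u where "u \<in> input_map C x" "grad V x \<bullet> f (x, u) < - \<alpha> (infdist x A)"
    unfolding INF_less_iff by auto
  then show thesis using that by simp
qed

text \<open>The approximating controls converge to a point \<open>z\<close> on the segment from \<open>v\<close> to \<open>u0\<close>, close to \<open>v\<close>.
  By convexity the decrease at \<open>z\<close> is strict, so that the controls near \<open>z\<close> which lower
  semicontinuity of \<open>input_map C\<close> supplies at nearby states still satisfy the weak inequality.\<close>

lemma T_c_inner_approximation:
  fixes V :: "'x::euclidean_space \<Rightarrow> real" and f :: "'x \<times> 'u::euclidean_space \<Rightarrow> 'x"
  assumes hbc: "hybrid_basic_conditions U C D f g"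
    and W: "open W" "C1_on W V" "x \<in> W" and \<alpha>: "continuous_on {0..} \<alpha>"
    and lsc: "lsc_at (input_map C) x"
    and cvx: "convex_on (input_map C x) (\<lambda>u. grad V x \<bullet> f (x, u))"
    and u0: "u0 \<in> input_map C x" "grad V x \<bullet> f (x, u0) + \<alpha> (infdist x A) < 0"
    and v: "v \<in> T_c U C f A V \<alpha> x" and e: "e > 0" and y: "y \<longlonglongrightarrow> x"
  shows "\<exists>w z. w \<longlonglongrightarrow> z \<and> norm z < norm v + e \<and>
           (\<forall>\<^sub>F i in sequentially. w i \<in> T_c U C f A V \<alpha> (y i))"
proof -
  have C: "C \<subseteq> UNIV \<times> U" and f: "continuous_on UNIV f"
    using hbc unfolding hybrid_basic_conditions_def by auto
  \<comment> \<open>Small enough that moving from \<open>v\<close> towards \<open>u0\<close> costs less than \<open>e\<close> in norm; the summand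
    \<open>1\<close> guards against \<open>u0 = 0\<close>.\<close>
  define l where "l = min 1 (e / (2 * (norm u0 + 1)))"
  have pos: "norm u0 + 1 > 0" using norm_ge_zero[of u0] by linarith
  have l: "0 < l" "l \<le> 1" unfolding l_def using e pos by auto
  have "l * norm u0 \<le> e / (2 * (norm u0 + 1)) * (norm u0 + 1)"
    unfolding l_def using e pos by (intro mult_mono) auto
  also have "\<dots> = e / 2" using pos by (simp add: field_simps)
  finally have small: "l * norm u0 < e" using e by simp
  define z where "z = (1 - l) *\<^sub>R v + l *\<^sub>R u0"
  have "norm z \<le> (1 - l) * norm v + l * norm u0"
    unfolding z_def using l norm_triangle_ineq[of "(1 - l) *\<^sub>R v" "l *\<^sub>R u0"] by simp
  also have "\<dots> \<le> norm v + l * norm u0"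
    using l mult_left_le_one_le[of "norm v" "1 - l"] by simp
  finally have norm_z: "norm z < norm v + e" using small by simp
  have vC: "v \<in> input_map C x" and v_le: "grad V x \<bullet> f (x, v) + \<alpha> (infdist x A) \<le> 0"
    using v by (auto simp: mem_T_c_iff input_map_def)
  have zC: "z \<in> input_map C x"
    using cvx vC u0(1) l unfolding z_def convex_on_def by (auto intro: convexD)
  have "grad V x \<bullet> f (x, z) \<le> (1 - l) * (grad V x \<bullet> f (x, v)) + l * (grad V x \<bullet> f (x, u0))"
    using convex_onD[OF cvx, of l v u0] vC u0(1) l unfolding z_def by simp
  also have "\<dots> < (1 - l) * (- \<alpha> (infdist x A)) + l * (- \<alpha> (infdist x A))"
    using l u0(2) v_le by (intro add_le_less_mono mult_left_mono mult_strict_left_mono) auto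
  finally have z_neg: "grad V x \<bullet> f (x, z) + \<alpha> (infdist x A) < 0" by (simp add: algebra_simps)
  obtain w where w: "w \<longlonglongrightarrow> z" "\<forall>\<^sub>F i in sequentially. w i \<in> input_map C (y i)"
    using lsc zC y unfolding lsc_at_def setmap_liminf_def by blast
  have "\<forall>\<^sub>F i in sequentially. grad V (y i) \<bullet> f (y i, w i) + \<alpha> (infdist (y i) A) < 0"
    using order_tendstoD(2)[OF decay_defect_tendsto[OF W f \<alpha> y w(1)] z_neg] .
  with w(2) have "\<forall>\<^sub>F i in sequentially. w i \<in> T_c U C f A V \<alpha> (y i)"
    by eventually_elim (use C in \<open>auto simp: mem_T_c_iff input_map_def\<close>)
  then show ?thesis using w(1) norm_z by blast
qed

section \<open>Stability of the closed loop\<close>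

text \<open>Although \<open>V\<close> need not be proper on the whole space, the bound by \<open>\<alpha>1\<close> restricts attention to a
  compact set, on whose points at distance at least \<open>\<epsilon>\<close> from the sublevel set \<open>V\<close> has a minimum
  greater than \<open>r\<close>.\<close>

lemma compact_sublevel_separation:
  fixes V :: "'x::euclidean_space \<Rightarrow> real"
  assumes A: "compact A" "A \<noteq> {}" and V: "continuous_on UNIV V" and K: "class_K_inf \<alpha>1"
    and "\<epsilon> > 0"
  shows "\<exists>\<eta>>0. \<forall>x. \<alpha>1 (infdist x A) \<le> V x \<and> V x \<le> r + \<eta> \<longrightarrow> infdist x (sublevel V r) < \<epsilon>"
proof -
  obtain b where b: "b \<ge> 0" "\<alpha>1 b > r + 1" using K unfolding class_K_inf_def by blast
  define S where "S = {x. infdist x A \<le> b + 1} \<inter> {x. \<epsilon> \<le> infdist x (sublevel V r)}"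
  have "compact S" unfolding S_def
    using A b(1) by (intro compact_Int_closed compact_infdist_le closed_Collect_le continuous_intros) auto
  have in_S: "x \<in> S" if "\<alpha>1 (infdist x A) \<le> V x" "V x \<le> r + 1" "\<epsilon> \<le> infdist x (sublevel V r)" for x
    using that b class_K_inf_less_iff[OF K b(1) infdist_nonneg, of x A] unfolding S_def by simp
  show ?thesis
  proof (cases "S = {}")
    case True
    then show ?thesis using in_S by (intro exI[of _ 1]) (auto simp: not_less[symmetric])
  next
    case False
    then obtain m where m: "m \<in> S" "\<And>x. x \<in> S \<Longrightarrow> V m \<le> V x"
      using continuous_attains_inf[OF \<open>compact S\<close>, of V] V continuous_on_subset by blast
    have "V m > r"
    proof (rule ccontr)
      assume "\<not> V m > r"
      then have "m \<in> sublevel V r" by (simp add: sublevel_def)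
      then show False using m(1) \<open>\<epsilon> > 0\<close> by (simp add: S_def)
    qed
    then have "min 1 ((V m - r) / 2) > 0" by simp
    moreover have "infdist x (sublevel V r) < \<epsilon>"
      if "\<alpha>1 (infdist x A) \<le> V x" "V x \<le> r + min 1 ((V m - r) / 2)" for x
    proof (rule ccontr)
      assume "\<not> ?thesis"
      then have "x \<in> S" using in_S[of x] that by simp
      moreover have "V x \<le> r + (V m - r) / 2" using that(2) min.cobounded2[of 1 "(V m - r) / 2"] by linarith
      ultimately show False using m(2)[of x] \<open>V m > r\<close> by (simp add: field_simps)
    qed
    ultimately show ?thesis by blast
  qed
qed

lemma compact_sublevel_inflate:
  fixes V :: "'x::euclidean_space \<Rightarrow> real"
  assumes V: "continuous_on UNIV V" and K: "compact (sublevel V r)" and "\<eta> > 0"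
  shows "\<exists>\<delta>>0. \<forall>x\<in>inflate (sublevel V r) \<delta>. V x \<le> r + \<eta>"
proof -
  have "open {x. V x < r + \<eta>}" using V by (intro open_Collect_less) auto
  moreover have "sublevel V r \<subseteq> {x. V x < r + \<eta>}" using \<open>\<eta> > 0\<close> by (auto simp: sublevel_def)
  ultimately obtain e where "e > 0" "(\<Union>x\<in>sublevel V r. cball x e) \<subseteq> {x. V x < r + \<eta>}"
    using compact_subset_open_imp_cball_epsilon_subset[OF K] by metis
  then show ?thesis by (intro exI[of _ e]) (auto simp: inflate_def less_imp_le subset_eq)
qed

text \<open>Above level \<open>r\<close> the law selects from the regulation map, which means decrease at rate \<open>\<alpha>\<close>.  The rate \<open>\<alpha> = \<alpha>3\<close> is included, so that the lemma serves both the constructed law and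
  any given law for \<open>\<alpha>3\<close>.\<close>

lemma sublevel_asymptotically_stable:
  fixes V :: "'x::euclidean_space \<Rightarrow> real" and f :: "'x \<times> 'u::euclidean_space \<Rightarrow> 'x"
  assumes A: "compact A" "A \<noteq> {}"
    and clf: "control_lyapunov_function U C D f g A V \<alpha>3"
    and \<alpha>: "positive_definite \<alpha>" "\<And>s. s \<ge> 0 \<Longrightarrow> \<alpha> s \<le> \<alpha>3 s"
    and r: "r > 0"
    and \<rho>: "min_norm_law (T_c U C f A V \<alpha>) (R_c U C V \<inter> superlevel V r) \<rho>"
    and K: "compact (sublevel V r)"
  shows "renders_asymptotically_stable U C D f g \<rho> (sublevel V r)"
proof -
  from clf obtain W \<alpha>1 \<alpha>2 where V: "continuous_on UNIV V"
    and W: "open W" "closure (state_proj U C) \<subseteq> W" "C1_on W V"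
    and \<alpha>12: "class_K_inf \<alpha>1" "class_K_inf \<alpha>2"
    and bounds: "\<forall>x \<in> state_proj U C \<union> D \<union> g ` D.
           \<alpha>1 (infdist x A) \<le> V x \<and> V x \<le> \<alpha>2 (infdist x A)"
    and jump: "\<forall>x \<in> D. V (g x) - V x \<le> - \<alpha>3 (infdist x A)"
    unfolding control_lyapunov_function_def by blast
  define F where "F = {x \<in> state_proj U C. (x, \<rho> x) \<in> C}"
  have F: "F \<subseteq> state_proj U C" unfolding F_def by blast
  have "asymptotically_stable F (\<lambda>x. f (x, \<rho> x)) D g (sublevel V r)"
  proof (rule asymptotically_stable_lyapunov[OF A W(1) _ W(3) V \<alpha>12 _ \<alpha>(1), where s = r])
    show "closure F \<subseteq> W" using W(2) closure_mono[OF F] by blast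
    show "\<alpha>1 (infdist x A) \<le> V x \<and> V x \<le> \<alpha>2 (infdist x A)" if "x \<in> F \<union> D \<union> g ` D" for x
      using bounds F that by blast
    show "grad V x \<bullet> f (x, \<rho> x) \<le> - \<alpha> (infdist x A)" if "x \<in> F" "r < V x" for x
    proof -
      have "x \<in> R_c U C V \<inter> superlevel V r"
        using that F r by (auto simp: R_c_def superlevel_def)
      then have "\<rho> x \<in> T_c U C f A V \<alpha> x"
        using \<rho> unfolding min_norm_law_def is_arg_min_def by blast
      then show ?thesis by (simp add: mem_T_c_iff)
    qed
    show "V (g x) - V x \<le> - \<alpha> (infdist x A)" if "x \<in> D" for x
      using jump that \<alpha>(2)[OF infdist_nonneg, of x A] by fastforce
    show "\<exists>\<eta>>0. \<forall>x. \<alpha>1 (infdist x A) \<le> V x \<and> V x \<le> r + \<eta> \<longrightarrow> infdist x (sublevel V r) < \<epsilon>"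
      if "\<epsilon> > 0" for \<epsilon>
      by (rule compact_sublevel_separation[OF A V \<alpha>12(1) that])
    show "\<exists>\<delta>>0. \<forall>x\<in>inflate (sublevel V r) \<delta>. V x \<le> \<alpha>2 (infdist x A) \<longrightarrow> V x \<le> r + \<eta>"
      if "\<eta> > 0" for \<eta>
      using compact_sublevel_inflate[OF V K that] by blast
  qed (use r in simp)
  then show ?thesis unfolding renders_asymptotically_stable_def F_def .
qed

text \<open>Where \<open>V\<close> is positive, \<open>T1_c\<close> is \<open>T_c\<close> and yields decrease; the remaining points of
  \<open>state_proj U C\<close> form the zero level, above which solutions cannot climb.\<close>

lemma attractor_asymptotically_stable:
  fixes V :: "'x::euclidean_space \<Rightarrow> real" and f :: "'x \<times> 'u::euclidean_space \<Rightarrow> 'x"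
  assumes A: "compact A" "A \<noteq> {}"
    and clf: "control_lyapunov_function U C D f g A V \<alpha>3"
    and \<rho>: "min_norm_law (T1_c U C f A V \<alpha>3 \<rho>0) (state_proj U C) \<rho>"
  shows "renders_asymptotically_stable U C D f g \<rho> A"
proof -
  from clf obtain W \<alpha>1 \<alpha>2 where V: "continuous_on UNIV V"
    and W: "open W" "closure (state_proj U C) \<subseteq> W" "C1_on W V"
    and \<alpha>3: "positive_definite \<alpha>3"
    and \<alpha>12: "class_K_inf \<alpha>1" "class_K_inf \<alpha>2"
    and bounds: "\<forall>x \<in> state_proj U C \<union> D \<union> g ` D.
           \<alpha>1 (infdist x A) \<le> V x \<and> V x \<le> \<alpha>2 (infdist x A)"
    and jump: "\<forall>x \<in> D. V (g x) - V x \<le> - \<alpha>3 (infdist x A)"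
    unfolding control_lyapunov_function_def by blast
  define F where "F = {x \<in> state_proj U C. (x, \<rho> x) \<in> C}"
  have F: "F \<subseteq> state_proj U C" unfolding F_def by blast
  have "asymptotically_stable F (\<lambda>x. f (x, \<rho> x)) D g A"
  proof (rule asymptotically_stable_lyapunov[OF A W(1) _ W(3) V \<alpha>12 _ \<alpha>3, where s = 0])
    show "closure F \<subseteq> W" using W(2) closure_mono[OF F] by blast
    show "\<alpha>1 (infdist x A) \<le> V x \<and> V x \<le> \<alpha>2 (infdist x A)" if "x \<in> F \<union> D \<union> g ` D" for x
      using bounds F that by blast
    show "grad V x \<bullet> f (x, \<rho> x) \<le> - \<alpha>3 (infdist x A)" if "x \<in> F" "0 < V x" for x
    proof -
      have "\<rho> x \<in> T_c U C f A V \<alpha>3 x"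
        using \<rho> F that T1_c_eq_T_c[of x U C V] unfolding min_norm_law_def is_arg_min_def by blast
      then show ?thesis by (simp add: mem_T_c_iff)
    qed
    show "V (g x) - V x \<le> - \<alpha>3 (infdist x A)" if "x \<in> D" for x
      using jump that by blast
    show "\<exists>\<eta>>0. \<forall>x. \<alpha>1 (infdist x A) \<le> V x \<and> V x \<le> 0 + \<eta> \<longrightarrow> infdist x A < \<epsilon>"
      if "\<epsilon> > 0" for \<epsilon>
    proof -
      have pos: "\<alpha>1 \<epsilon> > 0"
        using class_K_inf_less_iff[OF \<alpha>12(1), of 0 \<epsilon>] that \<alpha>12(1) by (simp add: class_K_inf_def)
      have "infdist x A < \<epsilon>" if "\<alpha>1 (infdist x A) \<le> V x" "V x \<le> \<alpha>1 \<epsilon> / 2" for x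
        using class_K_inf_less_iff[OF \<alpha>12(1) infdist_nonneg, of \<epsilon> x A] that pos \<open>\<epsilon> > 0\<close> by simp
      then show ?thesis using pos by (intro exI[of _ "\<alpha>1 \<epsilon> / 2"]) auto
    qed
    show "\<exists>\<delta>>0. \<forall>x\<in>inflate A \<delta>. V x \<le> \<alpha>2 (infdist x A) \<longrightarrow> V x \<le> 0 + \<eta>" if "\<eta> > 0" for \<eta>
    proof -
      obtain d where d: "d > 0" "\<And>s. 0 \<le> s \<Longrightarrow> s < d \<Longrightarrow> \<alpha>2 s < \<eta>"
        using class_K_inf_small[OF \<alpha>12(2) \<open>\<eta> > 0\<close>] by blast
      have "V x \<le> \<eta>" if "x \<in> inflate A (d / 2)" "V x \<le> \<alpha>2 (infdist x A)" for x
        using d(2)[OF infdist_nonneg, of x A] infdist_le_if_inflate[OF that(1)] d(1) that(2) by simp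
      then show ?thesis using d(1) by (intro exI[of _ "d / 2"]) auto
    qed
  qed simp
  then show ?thesis unfolding renders_asymptotically_stable_def F_def .
qed


section \<open>Existence and continuity of the minimum-norm laws\<close>

lemma T_c_min_norm_law:
  fixes V :: "'x::euclidean_space \<Rightarrow> real" and f :: "'x \<times> 'u::euclidean_space \<Rightarrow> 'x"
  assumes hbc: "hybrid_basic_conditions U C D f g"
    and clf: "control_lyapunov_function U C D f g A V \<alpha>3"
    and less: "\<And>x. x \<in> X \<Longrightarrow> \<alpha> (infdist x A) < \<alpha>3 (infdist x A)" and X: "X \<subseteq> state_proj U C"
    and \<rho>: "\<And>x. x \<in> X \<Longrightarrow> \<rho> x = closest_point (T_c U C f A V \<alpha> x) 0"
  shows "min_norm_law (T_c U C f A V \<alpha>) X \<rho>"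
  unfolding min_norm_law_def
proof
  fix x assume x: "x \<in> X"
  obtain u where u: "u \<in> input_map C x" "grad V x \<bullet> f (x, u) + \<alpha> (infdist x A) < 0"
    using clf_strict_control[of U C D f g A V \<alpha>3 x \<alpha>] clf less[OF x] x X by blast
  have "C \<subseteq> UNIV \<times> U" using hbc unfolding hybrid_basic_conditions_def by blast
  then have "u \<in> T_c U C f A V \<alpha> x" using u by (auto simp: mem_T_c_iff input_map_def)
  then show "is_arg_min norm (\<lambda>u. u \<in> T_c U C f A V \<alpha> x) (\<rho> x)"
    using min_norm_exists[OF closed_T_c[OF hbc]] \<rho>[OF x] by fastforce
qed

lemma T_c_min_norm_law_continuous_on:
  fixes V :: "'x::euclidean_space \<Rightarrow> real" and f :: "'x \<times> 'u::euclidean_space \<Rightarrow> 'x"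
  assumes hbc: "hybrid_basic_conditions U C D f g"
    and clf: "control_lyapunov_function U C D f g A V \<alpha>3"
    and \<alpha>: "continuous_on {0..} \<alpha>"
    and less: "\<And>x. x \<in> X \<Longrightarrow> \<alpha> (infdist x A) < \<alpha>3 (infdist x A)" and X: "X \<subseteq> state_proj U C"
    and lsc: "\<And>x. lsc_at (input_map C) x"
    and cvx: "\<And>x. x \<in> X \<Longrightarrow> convex_on (input_map C x) (\<lambda>u. grad V x \<bullet> f (x, u))"
    and \<rho>: "min_norm_law (T_c U C f A V \<alpha>) X \<rho>"
  shows "continuous_on X \<rho>"
  unfolding continuous_on_eq_continuous_within
proof
  fix x assume x: "x \<in> X"
  obtain W where W: "open W" "closure (state_proj U C) \<subseteq> W" "C1_on W V"
    using clf unfolding control_lyapunov_function_def by blast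
  have xW: "x \<in> W" using x X W(2) closure_subset by blast
  have C: "C \<subseteq> UNIV \<times> U" using hbc unfolding hybrid_basic_conditions_def by blast
  have mem: "\<rho> y \<in> T_c U C f A V \<alpha> y" if "y \<in> X" for y
    using \<rho> that unfolding min_norm_law_def is_arg_min_def by blast
  obtain u where u: "u \<in> input_map C x" "grad V x \<bullet> f (x, u) + \<alpha> (infdist x A) < 0"
    using clf_strict_control[of U C D f g A V \<alpha>3 x \<alpha>] clf less[OF x] x X by blast
  show "continuous (at x within X) \<rho>"
  proof (rule min_norm_law_continuous_at[OF \<rho>])
    fix y e assume "\<And>i. y i \<in> X" "y \<longlonglongrightarrow> x" "(e :: real) > 0"
    then show "\<exists>w z. w \<longlonglongrightarrow> z \<and> norm z < norm (\<rho> x) + e \<and>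
        (\<forall>\<^sub>F i in sequentially. w i \<in> T_c U C f A V \<alpha> (y i))"
      using T_c_inner_approximation[OF hbc W(1,3) xW \<alpha> lsc cvx[OF x] u mem[OF x]] by blast
  next
    fix y v assume y: "\<And>i. y i \<in> X" "y \<longlonglongrightarrow> x" "(\<lambda>i. \<rho> (y i)) \<longlonglongrightarrow> v" "norm v \<le> norm (\<rho> x)"
    have "v \<in> T_c U C f A V \<alpha> x"
      by (rule T_c_limit[OF hbc W(1,3) xW \<alpha> y(2,3)]) (use mem y(1) in simp)
    then show "v = \<rho> x"
      using min_norm_unique[OF convex_T_c[OF C cvx[OF x]] closed_T_c[OF hbc] _ _ y(4)]
        \<rho> x unfolding min_norm_law_def by blast
  qed
qed

text \<open>Where \<open>V > 0\<close> limits of selected controls stay in the map, as \<open>T1_c\<close> agrees with \<open>T_c\<close> nearby.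
  On the zero level limits may leave the map, but there the selected control is \<open>0\<close>, and upper
  semicontinuity of the norm alone gives continuity.\<close>

lemma T1_c_min_norm_law_continuous_on:
  fixes V :: "'x::euclidean_space \<Rightarrow> real" and f :: "'x \<times> 'u::euclidean_space \<Rightarrow> 'x"
  assumes hbc: "hybrid_basic_conditions U C D f g"
    and clf: "control_lyapunov_function U C D f g A V \<alpha>3"
    and cvx: "\<And>x. x \<in> state_proj U C \<Longrightarrow> V x > 0 \<Longrightarrow>
        convex_on (input_map C x) (\<lambda>u. grad V x \<bullet> f (x, u))"
    and lsc: "\<And>x. x \<in> state_proj U C \<Longrightarrow> lsc_at (T1_c U C f A V \<alpha>3 (\<lambda>_. 0)) x"
    and \<rho>: "min_norm_law (T1_c U C f A V \<alpha>3 (\<lambda>_. 0)) (state_proj U C) \<rho>"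
  shows "continuous_on (state_proj U C) \<rho>"
  unfolding continuous_on_eq_continuous_within
proof
  fix x assume x: "x \<in> state_proj U C"
  obtain W where W: "open W" "closure (state_proj U C) \<subseteq> W" "C1_on W V"
    and V: "continuous_on UNIV V" and \<alpha>3: "continuous_on {0..} \<alpha>3"
    using clf unfolding control_lyapunov_function_def positive_definite_def by blast
  have xW: "x \<in> W" using x W(2) closure_subset by blast
  have C: "C \<subseteq> UNIV \<times> U" using hbc unfolding hybrid_basic_conditions_def by blast
  have mem: "\<rho> y \<in> T1_c U C f A V \<alpha>3 (\<lambda>_. 0) y" if "y \<in> state_proj U C" for y
    using \<rho> that unfolding min_norm_law_def is_arg_min_def by blast
  show "continuous (at x within state_proj U C) \<rho>"
  proof (rule min_norm_law_continuous_at[OF \<rho>])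
    fix y e assume y: "\<And>i. y i \<in> state_proj U C" "y \<longlonglongrightarrow> x" "(e :: real) > 0"
    have "\<rho> x \<in> setmap_liminf (T1_c U C f A V \<alpha>3 (\<lambda>_. 0)) x"
      using mem[OF x] lsc[OF x] unfolding lsc_at_def by blast
    then obtain w where "w \<longlonglongrightarrow> \<rho> x" "\<forall>\<^sub>F i in sequentially. w i \<in> T1_c U C f A V \<alpha>3 (\<lambda>_. 0) (y i)"
      using y(2) unfolding setmap_liminf_def by blast
    then show "\<exists>w z. w \<longlonglongrightarrow> z \<and> norm z < norm (\<rho> x) + e \<and>
        (\<forall>\<^sub>F i in sequentially. w i \<in> T1_c U C f A V \<alpha>3 (\<lambda>_. 0) (y i))"
      using y(3) by (intro exI[of _ w] exI[of _ "\<rho> x"]) simp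
  next
    fix y v assume y: "\<And>i. y i \<in> state_proj U C" "y \<longlonglongrightarrow> x" "(\<lambda>i. \<rho> (y i)) \<longlonglongrightarrow> v" "norm v \<le> norm (\<rho> x)"
    show "v = \<rho> x"
    proof (cases "V x > 0")
      case False
      then have "\<rho> x = 0" using mem[OF x] by (simp add: T1_c_zero_level)
      then show ?thesis using y(4) by simp
    next
      case True
      have "(\<lambda>i. V (y i)) \<longlonglongrightarrow> V x"
        using V y(2) by (intro isCont_tendsto_compose[of x V]) (auto simp: continuous_on_eq_continuous_at)
      then have "\<forall>\<^sub>F i in sequentially. V (y i) > 0" using True by (rule order_tendstoD(1))
      then have "\<forall>\<^sub>F i in sequentially. \<rho> (y i) \<in> T_c U C f A V \<alpha>3 (y i)"
        by eventually_elim (use mem[OF y(1)] T1_c_eq_T_c[OF y(1)] in blast)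
      then have "v \<in> T_c U C f A V \<alpha>3 x"
        by (rule T_c_limit[OF hbc W(1,3) xW \<alpha>3 y(2,3)])
      moreover have "is_arg_min norm (\<lambda>u. u \<in> T_c U C f A V \<alpha>3 x) (\<rho> x)"
        using \<rho> x True T1_c_eq_T_c[of x U C V f A \<alpha>3 "\<lambda>_. 0"] unfolding min_norm_law_def by metis
      ultimately show ?thesis
        using min_norm_unique[OF convex_T_c[OF C cvx[OF x True]] closed_T_c[OF hbc] _ _ y(4)] by blast
    qed
  qed
qed

section \<open>Stabilization by minimum-norm feedback\<close>

theorem corollary3p6:
  fixes U :: "(real ^ 'm::finite) set" and C :: "((real ^ 'n::finite) \<times> (real ^ 'm)) set"
    and D A :: "(real ^ 'n) set"
    and f :: "(real ^ 'n) \<times> (real ^ 'm) \<Rightarrow> real ^ 'n" and g :: "real ^ 'n \<Rightarrow> real ^ 'n"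
    and V :: "real ^ 'n \<Rightarrow> real" and \<alpha>3 :: "real \<Rightarrow> real"
  assumes A: "compact A" "A \<noteq> {}"
    and hbc: "hybrid_basic_conditions U C D f g"
    and clf: "control_lyapunov_function U C D f g A V \<alpha>3"
    and M1c: "\<forall>x. lsc_at (input_map C) x" "\<forall>x. convex (input_map C x)"
    and M2c: "\<forall>r>0. \<forall>x \<in> state_proj U C \<inter> superlevel V r.
                convex_on (input_map C x) (\<lambda>u. real_of_ereal (Gamma_c C f A V \<alpha>3 x u r))"
  shows
    \<comment> \<open>first part, for every decay rate strictly below \<open>\<alpha>3\<close>\<close>
    "(\<forall>\<alpha>. positive_definite \<alpha> \<and> (\<forall>s>0. \<alpha> s < \<alpha>3 s) \<longrightarrow>
        (\<forall>r>0. \<exists>\<rho>'. (\<forall>x \<in> state_proj U C. \<rho>' x \<in> U) \<and>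
            min_norm_law (T_c U C f A V \<alpha>) (R_c U C V \<inter> superlevel V r) \<rho>' \<and>
            (compact (sublevel V r) \<longrightarrow>
               renders_asymptotically_stable U C D f g \<rho>' (sublevel V r)) \<and>
            (closed_graph (input_map C) \<longrightarrow>
               continuous_on (state_proj U C \<inter> superlevel V r) \<rho>'))) \<and>
    \<comment> \<open>stabilization by the law built with \<open>\<alpha>3\<close> itself, whenever its minimizers exist\<close>
     (\<forall>r>0. \<forall>\<rho>'. (\<forall>x \<in> state_proj U C. \<rho>' x \<in> U) \<and>
            min_norm_law (T_c U C f A V \<alpha>3) (R_c U C V \<inter> superlevel V r) \<rho>' \<and>
            compact (sublevel V r) \<longrightarrow>
               renders_asymptotically_stable U C D f g \<rho>' (sublevel V r)) \<and>
    \<comment> \<open>second part\<close>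
     (0 \<in> U \<and>
      (\<forall>E \<phi>. maximal_solution (state_proj U C \<inter> A) (\<lambda>x. f (x, 0)) {} g E \<phi> \<longrightarrow>
         (\<forall>t. (t, 0) \<in> E \<longrightarrow> infdist (\<phi> t 0) A = 0)) \<and>
      (\<forall>x \<in> state_proj U C \<inter> superlevel V 0. lsc_at (T1_c U C f A V \<alpha>3 (\<lambda>_. 0)) x) \<longrightarrow>
      (\<forall>\<rho>. min_norm_law (T1_c U C f A V \<alpha>3 (\<lambda>_. 0)) (state_proj U C) \<rho> \<longrightarrow>
         renders_asymptotically_stable U C D f g \<rho> A \<and>
         (closed_graph (input_map C) \<longrightarrow> continuous_on (state_proj U C) \<rho>)))"
proof -
  have C: "C \<subseteq> UNIV \<times> U" using hbc unfolding hybrid_basic_conditions_def by blast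
  obtain \<alpha>1 \<alpha>2 where \<alpha>12: "class_K_inf \<alpha>1" "class_K_inf \<alpha>2"
    and \<alpha>3: "positive_definite \<alpha>3"
    and bounds: "\<And>x. x \<in> state_proj U C \<Longrightarrow> \<alpha>1 (infdist x A) \<le> V x \<and> V x \<le> \<alpha>2 (infdist x A)"
    using clf unfolding control_lyapunov_function_def by blast
  have V_nonneg: "V x \<ge> 0" if "x \<in> state_proj U C" for x
  proof -
    have "\<alpha>1 (infdist x A) \<ge> 0"
      using class_K_inf_less_iff[OF \<alpha>12(1) infdist_nonneg order_refl, of x A] \<alpha>12(1) infdist_nonneg[of x A]
      unfolding class_K_inf_def by linarith
    then show ?thesis using bounds[OF that] by linarith
  qed
  have off_A: "infdist x A > 0" if "x \<in> state_proj U C" "V x > 0" for x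
    using bounds[OF that(1)] that(2) \<alpha>12(2) infdist_nonneg[of x A] unfolding class_K_inf_def
    by (cases "infdist x A = 0") auto
  have cvx: "convex_on (input_map C x) (\<lambda>u. grad V x \<bullet> f (x, u))"
    if "x \<in> state_proj U C" "V x > 0" for x
    by (rule convex_on_flow_derivative[where r = "V x"]) (use M2c that in \<open>auto simp: superlevel_def\<close>)
  have part1: "\<exists>\<rho>'. (\<forall>x \<in> state_proj U C. \<rho>' x \<in> U) \<and>
            min_norm_law (T_c U C f A V \<alpha>) (R_c U C V \<inter> superlevel V r) \<rho>' \<and>
            (compact (sublevel V r) \<longrightarrow>
               renders_asymptotically_stable U C D f g \<rho>' (sublevel V r)) \<and>
            (closed_graph (input_map C) \<longrightarrow>
               continuous_on (state_proj U C \<inter> superlevel V r) \<rho>')"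
    if \<alpha>: "positive_definite \<alpha> \<and> (\<forall>s>0. \<alpha> s < \<alpha>3 s)" and r: "r > 0" for \<alpha> r
  proof -
    define X where "X = state_proj U C \<inter> superlevel V r"
    have X_eq: "R_c U C V \<inter> superlevel V r = X"
      using r by (auto simp: R_c_def X_def superlevel_def)
    have X: "X \<subseteq> state_proj U C" and X_pos: "\<And>x. x \<in> X \<Longrightarrow> V x > 0"
      using r by (auto simp: X_def superlevel_def)
    have less: "\<alpha> (infdist x A) < \<alpha>3 (infdist x A)" if "x \<in> X" for x
      using \<alpha> off_A X X_pos that by blast
    \<comment> \<open>Below level \<open>r\<close> any control in \<open>U\<close> will do.\<close>
    define \<rho> where "\<rho> x = (if x \<in> X then closest_point (T_c U C f A V \<alpha> x) 0
        else SOME u. u \<in> input_map C x)" for x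
    have law: "min_norm_law (T_c U C f A V \<alpha>) X \<rho>"
      by (rule T_c_min_norm_law[OF hbc clf less X]) (auto simp: \<rho>_def)
    have "\<rho> x \<in> U" if x: "x \<in> state_proj U C" for x
    proof (cases "x \<in> X")
      case True
      then show ?thesis using law unfolding min_norm_law_def is_arg_min_def by (simp add: mem_T_c_iff)
    next
      case False
      have "\<exists>u. u \<in> input_map C x" using x by (auto simp: state_proj_def input_map_def)
      then have "(SOME u. u \<in> input_map C x) \<in> input_map C x" by (rule someI_ex)
      then have "\<rho> x \<in> input_map C x" using False by (simp add: \<rho>_def)
      then show ?thesis using C by (auto simp: input_map_def)
    qed
    moreover have "renders_asymptotically_stable U C D f g \<rho> (sublevel V r)" if "compact (sublevel V r)"
    proof (rule sublevel_asymptotically_stable[OF A clf _ _ r _ that])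
      show "\<alpha> s \<le> \<alpha>3 s" if "s \<ge> 0" for s
        using \<alpha> \<alpha>3 that unfolding positive_definite_def by (cases "s = 0") (auto simp: less_imp_le)
    qed (use \<alpha> law X_eq in auto)
    moreover have "continuous_on X \<rho>"
      using \<alpha> M1c(1) X X_pos
      by (intro T_c_min_norm_law_continuous_on[OF hbc clf _ less X _ cvx law])
        (auto simp: positive_definite_def)
    ultimately show ?thesis using law X_eq unfolding X_def by (intro exI[of _ \<rho>]) auto
  qed
  have part2: "renders_asymptotically_stable U C D f g \<rho> (sublevel V r)"
    if "r > 0" "min_norm_law (T_c U C f A V \<alpha>3) (R_c U C V \<inter> superlevel V r) \<rho>"
      "compact (sublevel V r)" for r \<rho>
    by (rule sublevel_asymptotically_stable[OF A clf \<alpha>3 order_refl that])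
  have part3: "continuous_on (state_proj U C) \<rho>"
    if "\<forall>x \<in> state_proj U C \<inter> superlevel V 0. lsc_at (T1_c U C f A V \<alpha>3 (\<lambda>_. 0)) x"
      "min_norm_law (T1_c U C f A V \<alpha>3 (\<lambda>_. 0)) (state_proj U C) \<rho>" for \<rho>
    by (rule T1_c_min_norm_law_continuous_on[OF hbc clf cvx _ that(2)])
      (use that(1) V_nonneg in \<open>auto simp: superlevel_def\<close>)
  show ?thesis
    by (intro conjI allI impI part1) (auto intro: part2 part3 attractor_asymptotically_stable[OF A clf])
qed

end
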